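(* Let $\widetilde{\mathscr W}=\mathscr W(\Gamma,s)\oplus\big(C\otimes\mathbb F[t,t^{-1}]\big)$ be the central extension of $\mathscr W(\Gamma,s)$ with $C_k=C\otimes t^k$ ($k\in\mathbb Z$), $[\widetilde{\mathscr W},C_k]=0$ for all $k\in\mathbb Z$, $$[L_{\alpha,i},L_{\beta,j}]=(\beta-\alpha)L_{\alpha+\beta,i+j}+\delta_{\alpha+\beta,0}\frac{\alpha^3-\alpha}{12}C_{i+j},\qquad\alpha,\beta\in\Gamma,\ i,j\in\mathbb Z,$$ and all other brackets of the basis elements $L_{\alpha,i},M_{\alpha,i},Y_{\alpha+s,i}$ the same as in $\mathscr W(\Gamma,s)$. Then $\widetilde{\mathscr W}$ is the universal central extension of $\mathscr W(\Gamma,s)$.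
   Context: Let $\mathbb F$ be a field of characteristic $0$, $\Gamma$ a proper additive subgroup of $\mathbb F$, and $s\in\mathbb F$ with $s\notin\Gamma$, $2s\in\Gamma$. The generalized loop Schr\"odinger-Virasoro algebra $\mathscr W(\Gamma,s)$ is the Lie algebra over $\mathbb F$ with basis $\{L_{\alpha,i},M_{\alpha,i},Y_{\alpha+s,i}\mid\alpha\in\Gamma,\ i\in\mathbb Z\}$ and brackets $[L_{\alpha,i},L_{\beta,j}]=(\beta-\alpha)L_{\alpha+\beta,i+j}$, $[L_{\alpha,i},M_{\beta,j}]=\beta M_{\alpha+\beta,i+j}$, $[L_{\alpha,i},Y_{\beta+s,j}]=(\beta+s-\frac{\alpha}{2})Y_{\alpha+\beta+s,i+j}$, $[M_{\alpha,i},M_{\beta,j}]=0$, $[M_{\alpha,i},Y_{\beta+s,j}]=0$, $[Y_{\alpha+s,i},Y_{\beta+s,j}]=(\beta-\alpha)M_{\alpha+\beta+2s,i+j}$ for $\alpha,\beta\in\Gamma$, $i,j\in\mathbb Z$. Here $C$ is a symbol, so that $\{C_k\mid k\in\mathbb Z\}$ is a basis of $C\otimes\mathbb F[t,t^{-1}]$. *)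

theory Defs
  imports Complex_Main "HOL-Library.Poly_Mapping"
begin

subsection \<open>Lie algebras and universal central extensions\<close>

text \<open>
  The carrier is a linear subspace of an ambient vector space. This covers all Lie algebras up to
  isomorphism, because every vector space with basis \<open>B\<close> is isomorphic to a subspace of the
  space of finitely supported functions on a type containing \<open>B\<close>.
\<close>

record ('f, 'v) lie_struct =
  lcarrier :: "'v set"
  lscale :: "'f \<Rightarrow> 'v \<Rightarrow> 'v"
  lbracket :: "'v \<Rightarrow> 'v \<Rightarrow> 'v"

definition lie_algebra :: "('f::field, 'v::ab_group_add) lie_struct \<Rightarrow> bool" where
  "lie_algebra A \<longleftrightarrow>
     vector_space (lscale A) \<and>
     module.subspace (lscale A) (lcarrier A) \<and>
     (\<forall>x\<in>lcarrier A. \<forall>y\<in>lcarrier A. lbracket A x y \<in> lcarrier A) \<and>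
     (\<forall>x\<in>lcarrier A. \<forall>y\<in>lcarrier A. \<forall>z\<in>lcarrier A.
        lbracket A (x + y) z = lbracket A x z + lbracket A y z \<and>
        lbracket A z (x + y) = lbracket A z x + lbracket A z y) \<and>
     (\<forall>c. \<forall>x\<in>lcarrier A. \<forall>y\<in>lcarrier A.
        lbracket A (lscale A c x) y = lscale A c (lbracket A x y) \<and>
        lbracket A x (lscale A c y) = lscale A c (lbracket A x y)) \<and>
     (\<forall>x\<in>lcarrier A. lbracket A x x = 0) \<and>
     (\<forall>x\<in>lcarrier A. \<forall>y\<in>lcarrier A. \<forall>z\<in>lcarrier A.
        lbracket A x (lbracket A y z) + lbracket A y (lbracket A z x)
          + lbracket A z (lbracket A x y) = 0)"

definition lie_hom ::
  "('f::field, 'v::ab_group_add) lie_struct \<Rightarrow> ('f, 'w::ab_group_add) lie_struct \<Rightarrow> ('v \<Rightarrow> 'w) \<Rightarrow> bool"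
where
  "lie_hom A B h \<longleftrightarrow>
     (\<forall>x\<in>lcarrier A. h x \<in> lcarrier B) \<and>
     (\<forall>x\<in>lcarrier A. \<forall>y\<in>lcarrier A. h (x + y) = h x + h y) \<and>
     (\<forall>c. \<forall>x\<in>lcarrier A. h (lscale A c x) = lscale B c (h x)) \<and>
     (\<forall>x\<in>lcarrier A. \<forall>y\<in>lcarrier A. h (lbracket A x y) = lbracket B (h x) (h y))"

definition central_extension ::
  "('f::field, 'e::ab_group_add) lie_struct \<Rightarrow> ('f, 'g::ab_group_add) lie_struct \<Rightarrow> ('e \<Rightarrow> 'g) \<Rightarrow> bool"
where
  "central_extension E G p \<longleftrightarrow>
     lie_algebra E \<and> lie_algebra G \<and> lie_hom E G p \<and> p ` lcarrier E = lcarrier G \<and>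
     (\<forall>z\<in>lcarrier E. p z = 0 \<longrightarrow> (\<forall>x\<in>lcarrier E. lbracket E x z = 0))"

text \<open>
  A definition in HOL cannot quantify over types, so the type \<open>'x\<close> of the competing central
  extensions is a parameter; a theorem about it with \<open>'x\<close> schematic covers all of them.
  Homomorphisms are total functions, hence uniqueness is equality on the carrier.
\<close>

definition universal_central_extension ::
  "'x::ab_group_add itself \<Rightarrow> ('f::field, 'e::ab_group_add) lie_struct \<Rightarrow>
     ('f, 'g::ab_group_add) lie_struct \<Rightarrow> ('e \<Rightarrow> 'g) \<Rightarrow> bool"
where
  "universal_central_extension T E G p \<longleftrightarrow>
     central_extension E G p \<and>
     (\<forall>(X :: ('f, 'x) lie_struct) q. central_extension X G q \<longrightarrow>
        (\<exists>h. lie_hom E X h \<and> (\<forall>x\<in>lcarrier E. q (h x) = p x) \<and>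
           (\<forall>h'. lie_hom E X h' \<and> (\<forall>x\<in>lcarrier E. q (h' x) = p x)
              \<longrightarrow> (\<forall>x\<in>lcarrier E. h' x = h x))))"


subsection \<open>Structure constants\<close>

definition smult_pm :: "'f::field \<Rightarrow> ('b \<Rightarrow>\<^sub>0 'f) \<Rightarrow> ('b \<Rightarrow>\<^sub>0 'f)" where
  "smult_pm c = Poly_Mapping.map ((*) c)"

text \<open>The bilinear map on the vector space with basis \<open>'b\<close> that takes the values \<open>br\<close> on pairs of
  basis vectors.\<close>

definition bilinear_ext ::
  "('b \<Rightarrow> 'b \<Rightarrow> 'b \<Rightarrow>\<^sub>0 'f) \<Rightarrow> ('b \<Rightarrow>\<^sub>0 'f::field) \<Rightarrow> ('b \<Rightarrow>\<^sub>0 'f) \<Rightarrow> ('b \<Rightarrow>\<^sub>0 'f)"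
where
  "bilinear_ext br x y =
     (\<Sum>a\<in>Poly_Mapping.keys x. \<Sum>b\<in>Poly_Mapping.keys y.
        smult_pm (Poly_Mapping.lookup x a * Poly_Mapping.lookup y b) (br a b))"

lemma lookup_smult_pm [simp]:
  "Poly_Mapping.lookup (smult_pm c x) b = c * Poly_Mapping.lookup x b"
  by (simp add: smult_pm_def Poly_Mapping.map.rep_eq when_def)

lemma bilinear_ext_single:
  "bilinear_ext br (Poly_Mapping.single a 1) (Poly_Mapping.single b 1) = br a b"
  by (rule poly_mapping_eqI) (simp add: bilinear_ext_def)

definition supported_on :: "'b set \<Rightarrow> ('b \<Rightarrow>\<^sub>0 'f::zero) set" where
  "supported_on B = {x. Poly_Mapping.keys x \<subseteq> B}"


subsection \<open>Generalized loop Schroedinger-Virasoro algebras\<close>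

definition additive_subgroup :: "'f::ab_group_add set \<Rightarrow> bool" where
  "additive_subgroup G \<longleftrightarrow>
     0 \<in> G \<and> (\<forall>a\<in>G. \<forall>b\<in>G. a + b \<in> G) \<and> (\<forall>a\<in>G. - a \<in> G)"

text \<open>\<open>Ygen \<alpha> i\<close> stands for the basis element with subscript \<open>\<alpha> + s, i\<close>, where \<open>s\<close> is fixed.\<close>

datatype 'f sv_gen =
    Lgen 'f int
  | Mgen 'f int
  | Ygen 'f int
  | Cgen int

fun sv_bracket :: "'f::field \<Rightarrow> 'f sv_gen \<Rightarrow> 'f sv_gen \<Rightarrow> ('f sv_gen \<Rightarrow>\<^sub>0 'f)" where
  "sv_bracket s (Lgen \<alpha> i) (Lgen \<beta> j) = Poly_Mapping.single (Lgen (\<alpha> + \<beta>) (i + j)) (\<beta> - \<alpha>)"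
| "sv_bracket s (Lgen \<alpha> i) (Mgen \<beta> j) = Poly_Mapping.single (Mgen (\<alpha> + \<beta>) (i + j)) \<beta>"
| "sv_bracket s (Mgen \<beta> j) (Lgen \<alpha> i) = Poly_Mapping.single (Mgen (\<alpha> + \<beta>) (i + j)) (- \<beta>)"
| "sv_bracket s (Lgen \<alpha> i) (Ygen \<beta> j) = Poly_Mapping.single (Ygen (\<alpha> + \<beta>) (i + j)) (\<beta> + s - \<alpha> / 2)"
| "sv_bracket s (Ygen \<beta> j) (Lgen \<alpha> i) = Poly_Mapping.single (Ygen (\<alpha> + \<beta>) (i + j)) (- (\<beta> + s - \<alpha> / 2))"
| "sv_bracket s (Ygen \<alpha> i) (Ygen \<beta> j) = Poly_Mapping.single (Mgen (\<alpha> + \<beta> + 2 * s) (i + j)) (\<beta> - \<alpha>)"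
| "sv_bracket s _ _ = 0"

fun vir_cocycle :: "'f::field sv_gen \<Rightarrow> 'f sv_gen \<Rightarrow> ('f sv_gen \<Rightarrow>\<^sub>0 'f)" where
  "vir_cocycle (Lgen \<alpha> i) (Lgen \<beta> j) =
     (if \<alpha> + \<beta> = 0 then Poly_Mapping.single (Cgen (i + j)) ((\<alpha> ^ 3 - \<alpha>) / 12) else 0)"
| "vir_cocycle _ _ = 0"

definition sv_basis :: "'f set \<Rightarrow> 'f sv_gen set" where
  "sv_basis \<Gamma> = {Lgen \<alpha> i | \<alpha> i. \<alpha> \<in> \<Gamma>} \<union> {Mgen \<alpha> i | \<alpha> i. \<alpha> \<in> \<Gamma>} \<union> {Ygen \<alpha> i | \<alpha> i. \<alpha> \<in> \<Gamma>}"

definition loop_sv :: "'f set \<Rightarrow> 'f::field \<Rightarrow> ('f, 'f sv_gen \<Rightarrow>\<^sub>0 'f) lie_struct" where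
  "loop_sv \<Gamma> s =
     \<lparr>lcarrier = supported_on (sv_basis \<Gamma>),
      lscale = smult_pm,
      lbracket = bilinear_ext (sv_bracket s)\<rparr>"

definition loop_sv_ext :: "'f set \<Rightarrow> 'f::field \<Rightarrow> ('f, 'f sv_gen \<Rightarrow>\<^sub>0 'f) lie_struct" where
  "loop_sv_ext \<Gamma> s =
     \<lparr>lcarrier = supported_on (sv_basis \<Gamma> \<union> range Cgen),
      lscale = smult_pm,
      lbracket = bilinear_ext (\<lambda>a b. sv_bracket s a b + vir_cocycle a b)\<rparr>"

text \<open>The projection of the extension onto the first summand, along the span of the \<open>Cgen k\<close>.\<close>

definition sv_proj :: "'f set \<Rightarrow> ('f sv_gen \<Rightarrow>\<^sub>0 'f::field) \<Rightarrow> ('f sv_gen \<Rightarrow>\<^sub>0 'f)" where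
  "sv_proj \<Gamma> x =
     (\<Sum>b \<in> Poly_Mapping.keys x \<inter> sv_basis \<Gamma>. Poly_Mapping.single b (Poly_Mapping.lookup x b))"

end

theory Submission
  imports Defs
begin

text \<open>
  Idea. Given a central extension \<open>X\<close>, lift every basis element of weight \<open>w \<noteq> 0\<close> to an eigenvector
  of eigenvalue \<open>w\<close> of a lift \<open>D\<close> of \<open>L\<^sub>0\<^sub>,\<^sub>0\<close>; such lifts are unique. Two brackets \<open>[L\<^sub>-\<^sub>\<alpha>, L\<^sub>\<alpha>]\<close> and one
  bracket \<open>[L\<^sub>-\<^sub>e, M\<^sub>e]\<close> dictate the images of \<open>C\<close>, \<open>L\<^sub>0\<close> and \<open>M\<^sub>0\<close>. The failure of the resulting linear
  map to be a homomorphism is a 2-cocycle with central values that is invariant under \<open>D\<close>, hence lives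
  in total weight zero. After composition with a linear functional it is scalar, and
  Jacobi identities at a few well-chosen triples of weights force it to vanish. Uniqueness
  holds because the extension is perfect.
\<close>

subsection \<open>Lie algebras from structure constants\<close>

definition lin_ext :: "('f::field \<Rightarrow> 'v::ab_group_add \<Rightarrow> 'v) \<Rightarrow> ('b \<Rightarrow> 'v) \<Rightarrow> ('b \<Rightarrow>\<^sub>0 'f) \<Rightarrow> 'v" where
  "lin_ext sc f x = (\<Sum>b\<in>Poly_Mapping.keys x. sc (Poly_Mapping.lookup x b) (f b))"

context vector_space
begin

text \<open>Sums over the keys of \<open>x\<close>, \<open>y\<close> and \<open>x + y\<close> become
  comparable once all run over one finite set; the extra terms have coefficient zero.\<close>

lemma lin_ext_superset:
  assumes "finite S" "Poly_Mapping.keys x \<subseteq> S"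
  shows "lin_ext scale f x = (\<Sum>b\<in>S. scale (Poly_Mapping.lookup x b) (f b))"
  unfolding lin_ext_def
  using assms by (intro sum.mono_neutral_left) (auto simp: in_keys_iff)

lemma lin_ext_add: "lin_ext scale f (x + y) = lin_ext scale f x + lin_ext scale f y"
proof -
  let ?S = "Poly_Mapping.keys x \<union> Poly_Mapping.keys y"
  have "Poly_Mapping.keys (x + y) \<subseteq> ?S"
    by (rule Poly_Mapping.keys_add)
  then show ?thesis
    by (simp add: lin_ext_superset[of ?S] lookup_add scale_left_distrib sum.distrib)
qed

lemma lin_ext_smult: "lin_ext scale f (smult_pm c x) = scale c (lin_ext scale f x)"
proof -
  have "Poly_Mapping.keys (smult_pm c x) \<subseteq> Poly_Mapping.keys x"
    by (auto simp: in_keys_iff)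
  then show ?thesis
    by (simp add: lin_ext_superset[of "Poly_Mapping.keys x"] scale_sum_right)
qed

lemma lin_ext_single: "lin_ext scale f (Poly_Mapping.single b k) = scale k (f b)"
  by (subst lin_ext_superset[of "{b}"]) auto

lemma lin_ext_plus_fun: "lin_ext scale (\<lambda>b. f b + g b) x = lin_ext scale f x + lin_ext scale g x"
  by (simp add: lin_ext_def scale_right_distrib sum.distrib)

lemma lin_ext_scale_fun: "lin_ext scale (\<lambda>b. scale c (f b)) x = scale c (lin_ext scale f x)"
  by (simp add: lin_ext_def scale_sum_right mult.commute)

end

lemma vector_space_smult_pm: "vector_space (smult_pm :: 'f::field \<Rightarrow> ('b \<Rightarrow>\<^sub>0 'f) \<Rightarrow> _)"
  by unfold_locales (auto intro!: poly_mapping_eqI simp: lookup_add algebra_simps)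

interpretation pm: vector_space "smult_pm :: 'f::field \<Rightarrow> ('b \<Rightarrow>\<^sub>0 'f) \<Rightarrow> _"
  by (rule vector_space_smult_pm)

lemma smult_pm_single: "smult_pm c (Poly_Mapping.single b k) = Poly_Mapping.single b (c * k)"
  by (rule poly_mapping_eqI) (simp add: lookup_single when_def)

section \<open>Vectors supported on a set of basis elements\<close>

lemma supported_on_single: "Poly_Mapping.single b k \<in> supported_on B" if "b \<in> B"
  using that by (auto simp: supported_on_def)

lemma subspace_supported_on: "pm.subspace (supported_on B :: ('b \<Rightarrow>\<^sub>0 'f::field) set)"
proof -
  have "Poly_Mapping.keys (x + y) \<subseteq> B"
    if "Poly_Mapping.keys x \<subseteq> B" "Poly_Mapping.keys y \<subseteq> B" for x y :: "'b \<Rightarrow>\<^sub>0 'f"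
    using Poly_Mapping.keys_add[of x y] that by blast
  moreover have "Poly_Mapping.keys (smult_pm c x) \<subseteq> Poly_Mapping.keys x" for c and x :: "'b \<Rightarrow>\<^sub>0 'f"
    by (auto simp: in_keys_iff)
  ultimately show ?thesis
    unfolding pm.subspace_def supported_on_def by (simp, meson subset_trans)
qed

text \<open>A vector is the finite sum of its one-term parts, so additive statements need a check on
  multiples of basis elements only.\<close>

lemma supported_on_induct [consumes 1, case_names zero single add]:
  assumes "x \<in> supported_on B"
    and "P 0" and single: "\<And>b k. b \<in> B \<Longrightarrow> P (Poly_Mapping.single b k)"
    and add: "\<And>x y. x \<in> supported_on B \<Longrightarrow> y \<in> supported_on B \<Longrightarrow> P x \<Longrightarrow> P y \<Longrightarrow> P (x + y)"
  shows "P (x :: 'b \<Rightarrow>\<^sub>0 'f::field)"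
proof -
  have "(\<Sum>b\<in>S. Poly_Mapping.single b (Poly_Mapping.lookup x b)) \<in> supported_on B \<and>
        P (\<Sum>b\<in>S. Poly_Mapping.single b (Poly_Mapping.lookup x b))"
    if "finite S" "S \<subseteq> B" for S
    using that
  proof (induction S)
    case empty
    then show ?case using assms(2) by (simp add: supported_on_def)
  next
    case (insert b S)
    then show ?case
      by (auto intro!: add single pm.subspace_add[OF subspace_supported_on] supported_on_single)
  qed
  note this[of "Poly_Mapping.keys x"]
  moreover have "(\<Sum>b\<in>Poly_Mapping.keys x. Poly_Mapping.single b (Poly_Mapping.lookup x b)) = x"
    by (rule poly_mapping_eqI) (simp add: lookup_sum lookup_single when_def in_keys_iff)
  ultimately show ?thesis
    using assms(1) by (simp add: supported_on_def)
qed

lemma bilinear_ext_eq_lin_ext: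
  "bilinear_ext br x y = lin_ext smult_pm (\<lambda>a. lin_ext smult_pm (br a) y) x"
  by (simp add: bilinear_ext_def lin_ext_def pm.scale_sum_right)

lemma bilinear_ext_add_left: "bilinear_ext br (x + y) z = bilinear_ext br x z + bilinear_ext br y z"
  and bilinear_ext_add_right: "bilinear_ext br z (x + y) = bilinear_ext br z x + bilinear_ext br z y"
  and bilinear_ext_smult_left: "bilinear_ext br (smult_pm c x) z = smult_pm c (bilinear_ext br x z)"
  and bilinear_ext_smult_right: "bilinear_ext br z (smult_pm c x) = smult_pm c (bilinear_ext br z x)"
  by (simp_all add: bilinear_ext_eq_lin_ext pm.lin_ext_add pm.lin_ext_smult
      pm.lin_ext_plus_fun pm.lin_ext_scale_fun)

lemma bilinear_ext_zero [simp]: "bilinear_ext br 0 y = 0" "bilinear_ext br y 0 = 0"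
  by (simp_all add: bilinear_ext_def)

lemma bilinear_ext_single_single:
  "bilinear_ext br (Poly_Mapping.single a k) (Poly_Mapping.single b l) = smult_pm (k * l) (br a b)"
  by (simp add: bilinear_ext_eq_lin_ext pm.lin_ext_single)

lemma bilinear_ext_in_supported_on:
  assumes "\<And>a b. a \<in> B \<Longrightarrow> b \<in> B \<Longrightarrow> br a b \<in> supported_on B"
    and "x \<in> supported_on B" "y \<in> supported_on B"
  shows "bilinear_ext br x y \<in> supported_on B"
  unfolding bilinear_ext_def
  using assms by (intro pm.subspace_sum[OF subspace_supported_on]
      pm.subspace_scale[OF subspace_supported_on]) (auto simp: supported_on_def)

lemma bilinear_ext_antisym:
  assumes "\<And>a b. br a b = - br b a"
  shows "bilinear_ext br x y = - bilinear_ext br y x"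
proof -
  have "bilinear_ext br x y = (\<Sum>a\<in>Poly_Mapping.keys x. \<Sum>b\<in>Poly_Mapping.keys y.
        smult_pm (Poly_Mapping.lookup x a * Poly_Mapping.lookup y b) (- br b a))"
    unfolding bilinear_ext_def by (subst assms) (rule refl)
  also have "\<dots> = - bilinear_ext br y x"
    by (subst sum.swap) (simp add: bilinear_ext_def mult.commute sum_negf)
  finally show ?thesis .
qed

text \<open>Trilinearity carries the Jacobi identity from basis elements to all vectors, one
  argument at a time (\<open>J0\<close> to \<open>J3\<close>).\<close>

lemma lie_algebra_bilinear_ext:
  fixes br :: "'b \<Rightarrow> 'b \<Rightarrow> 'b \<Rightarrow>\<^sub>0 'f::field"
  assumes closed: "\<And>a b. a \<in> B \<Longrightarrow> b \<in> B \<Longrightarrow> br a b \<in> supported_on B"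
    and alt: "\<And>a. br a a = 0" and anti: "\<And>a b. br a b = - br b a"
    and jac: "\<And>a b c. bilinear_ext br (Poly_Mapping.single a 1) (br b c)
        + bilinear_ext br (Poly_Mapping.single b 1) (br c a)
        + bilinear_ext br (Poly_Mapping.single c 1) (br a b) = 0"
  shows "lie_algebra \<lparr>lcarrier = supported_on B, lscale = smult_pm, lbracket = bilinear_ext br\<rparr>"
proof -
  let ?b = "bilinear_ext br"
  note add = bilinear_ext_add_left bilinear_ext_add_right
  \<comment> \<open>The expression is quadratic in \<open>x\<close>, so the sum case uses
    antisymmetry to cancel the two mixed terms.\<close>
  have xx: "?b x x = 0" if "x \<in> supported_on B" for x
    using that
  proof (induction rule: supported_on_induct)
    case (add x y)
    then show ?case
      using bilinear_ext_antisym[of br x y, OF anti]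
      by (simp add: bilinear_ext_add_left bilinear_ext_add_right)
  qed (simp_all add: bilinear_ext_single_single alt)
  let ?J = "\<lambda>x y z. ?b x (?b y z) + ?b y (?b z x) + ?b z (?b x y)"
  have J0: "?J (Poly_Mapping.single a k) (Poly_Mapping.single b l) (Poly_Mapping.single c m) = 0"
    for a b c k l m
  proof -
    have 1: "Poly_Mapping.single a k = smult_pm k (Poly_Mapping.single a 1)" for a :: 'b and k :: 'f
      by (simp add: smult_pm_single)
    have "?J (Poly_Mapping.single a k) (Poly_Mapping.single b l) (Poly_Mapping.single c m)
      = smult_pm (k * l * m) (?J (Poly_Mapping.single a 1) (Poly_Mapping.single b 1) (Poly_Mapping.single c 1))"
      unfolding 1[of a k] 1[of b l] 1[of c m] bilinear_ext_smult_left bilinear_ext_smult_right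
        pm.scale_scale pm.scale_right_distrib by (simp add: mult_ac)
    then show ?thesis
      by (simp add: bilinear_ext_single_single jac)
  qed
  have J1: "?J (Poly_Mapping.single a k) (Poly_Mapping.single b l) z = 0"
    if "z \<in> supported_on B" for a b k l z
    using that
  proof (induction rule: supported_on_induct)
    case (add x y)
    have "?J (Poly_Mapping.single a k) (Poly_Mapping.single b l) (x + y) = ?J (Poly_Mapping.single a k) (Poly_Mapping.single b l) x + ?J (Poly_Mapping.single a k) (Poly_Mapping.single b l) y"
      by (simp add: add_ac bilinear_ext_add_left bilinear_ext_add_right)
    then show ?case
      using add.IH add.prems by simp
  qed (simp_all add: J0)
  have J2: "?J (Poly_Mapping.single a k) y z = 0"
    if "y \<in> supported_on B" "z \<in> supported_on B" for a k y z
    using that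
  proof (induction rule: supported_on_induct)
    case (add x y)
    have "?J (Poly_Mapping.single a k) (x + y) z = ?J (Poly_Mapping.single a k) x z + ?J (Poly_Mapping.single a k) y z"
      by (simp add: add_ac bilinear_ext_add_left bilinear_ext_add_right)
    then show ?case
      using add.IH add.prems by simp
  qed (simp_all add: J1)
  have J3: "?J x y z = 0"
    if "x \<in> supported_on B" "y \<in> supported_on B" "z \<in> supported_on B" for x y z
    using that
  proof (induction rule: supported_on_induct)
    case (add x x')
    have "?J (x + x') y z = ?J x y z + ?J x' y z"
      by (simp add: add_ac bilinear_ext_add_left bilinear_ext_add_right)
    then show ?case
      using add.IH add.prems by simp
  qed (simp_all add: J2)
  show ?thesis
    unfolding lie_algebra_def
    using xx J3 bilinear_ext_in_supported_on[of B br, OF closed] subspace_supported_on[of B]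
    by (auto simp: vector_space_smult_pm add bilinear_ext_smult_left bilinear_ext_smult_right)
qed

section \<open>Antisymmetry of bracket and cocycle, Jacobi identity of the bracket\<close>

abbreviation sv_ext_bracket :: "'f::field \<Rightarrow> 'f sv_gen \<Rightarrow> 'f sv_gen \<Rightarrow> ('f sv_gen \<Rightarrow>\<^sub>0 'f)" where
  "sv_ext_bracket s a b \<equiv> sv_bracket s a b + vir_cocycle a b"

lemma sv_bracket_anti: "sv_bracket s a b = - sv_bracket s b a"
  by (cases a; cases b) (simp_all add: single_uminus[symmetric] add_ac)

text \<open>The coefficient \<open>(\<alpha> ^ 3 - \<alpha>) / 12\<close> is odd in \<alpha>, and
  two L's contribute only if their subscripts are opposite.\<close>

lemma vir_cocycle_anti: "vir_cocycle a b = - vir_cocycle b (a :: 'f::field_char_0 sv_gen)"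
proof (cases a; cases b)
  fix \<alpha> \<beta> :: 'f and i j assume ab: "a = Lgen \<alpha> i" "b = Lgen \<beta> j"
  show ?thesis
  proof (cases "\<alpha> + \<beta> = 0")
    case True
    then have "\<beta> = - \<alpha>" by (simp add: eq_neg_iff_add_eq_0 add.commute)
    then show ?thesis
      unfolding ab by (simp add: single_uminus[symmetric] add_ac minus_divide_left)
  next
    case False
    then show ?thesis unfolding ab by (simp add: add.commute)
  qed
qed simp_all

lemma sv_bracket_alt: "sv_bracket s a a = 0"
  by (cases a) simp_all

lemma vir_cocycle_alt: "vir_cocycle a (a :: 'f::field_char_0 sv_gen) = 0"
  by (cases a) (auto simp flip: mult_2)

lemma sv_jacobi:
  "bilinear_ext (sv_bracket s) (Poly_Mapping.single a 1) (sv_bracket s b c)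
    + bilinear_ext (sv_bracket s) (Poly_Mapping.single b 1) (sv_bracket s c a)
    + bilinear_ext (sv_bracket s) (Poly_Mapping.single c 1) (sv_bracket s a (b :: 'f::field_char_0 sv_gen)) = 0"
  by (cases a; cases b; cases c)
    (simp_all add: bilinear_ext_single_single smult_pm_single add_ac single_add[symmetric],
     (simp add: field_simps)+)

subsection \<open>The extension\<close>

lemma bilinear_ext_plus_bracket:
  "bilinear_ext (\<lambda>a b. f a b + g a b) x y = bilinear_ext f x y + bilinear_ext g x y"
  by (simp add: bilinear_ext_eq_lin_ext pm.lin_ext_plus_fun)

lemma sv_bracket_Cgen [simp]: "sv_bracket s (Cgen k) b = 0" "sv_bracket s b (Cgen k) = 0"
  by (cases b; simp)+

lemma vir_cocycle_Cgen [simp]: "vir_cocycle (Cgen k) b = 0" "vir_cocycle b (Cgen k) = 0"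
  by (cases b; simp)+

text \<open>The cocycle takes its values in multiples of \<open>Cgen\<close> elements, which
  \<open>br\<close> kills on the right. This removes the central part of inner brackets.\<close>

lemma bilinear_ext_vir_cocycle_right:
  assumes "\<And>a k. br a (Cgen k) = 0"
  shows "bilinear_ext br x (vir_cocycle b c) = 0"
proof -
  have "bilinear_ext br x (Poly_Mapping.single (Cgen k) l) = 0" for k l
    by (simp add: bilinear_ext_eq_lin_ext pm.lin_ext_single assms lin_ext_def)
  then show ?thesis
    by (cases b; cases c) simp_all
qed

lemma vir_cocycle_LLL:
  fixes \<alpha> \<beta> \<gamma> :: "'f::field_char_0"
  shows "bilinear_ext vir_cocycle (Poly_Mapping.single (Lgen \<alpha> i) 1) (sv_bracket s (Lgen \<beta> j) (Lgen \<gamma> k))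
    = (if \<alpha> + \<beta> + \<gamma> = 0 then Poly_Mapping.single (Cgen (i + j + k)) ((\<gamma> - \<beta>) * (\<alpha> ^ 3 - \<alpha>) / 12) else 0)"
  by (simp add: bilinear_ext_single_single smult_pm_single add.assoc)

text \<open>Only three L's of total weight zero matter: \<open>vir_cocycle\<close> sees L's alone,
  and a bracket with a factor of another kind has no L component.\<close>

lemma vir_cocycle_jacobi:
  "bilinear_ext vir_cocycle (Poly_Mapping.single a 1) (sv_bracket s b c)
    + bilinear_ext vir_cocycle (Poly_Mapping.single b 1) (sv_bracket s c a)
    + bilinear_ext vir_cocycle (Poly_Mapping.single c 1) (sv_bracket s a (b :: 'f::field_char_0 sv_gen)) = 0"
proof (cases "\<exists>\<alpha> i \<beta> j \<gamma> k. a = Lgen \<alpha> i \<and> b = Lgen \<beta> j \<and> c = Lgen \<gamma> k")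
  case True
  then obtain \<alpha> i \<beta> j \<gamma> k where abc: "a = Lgen \<alpha> i" "b = Lgen \<beta> j" "c = Lgen \<gamma> k"
    by blast
  show ?thesis
  proof (cases "\<alpha> + \<beta> + \<gamma> = 0")
    case True
    then have cyc: "\<beta> + \<gamma> + \<alpha> = 0" "\<gamma> + \<alpha> + \<beta> = 0"
      by (simp_all add: add_ac)
    have idx: "j + k + i = i + j + k" "k + i + j = i + j + k"
      by simp_all
    \<comment> \<open>The linear terms cancel identically, and the cubic ones have the factor
      \<alpha> + \<beta> + \<gamma>.\<close>
    have 0: "(\<gamma> - \<beta>) * (\<alpha> ^ 3 - \<alpha>) + (\<alpha> - \<gamma>) * (\<beta> ^ 3 - \<beta>) + (\<beta> - \<alpha>) * (\<gamma> ^ 3 - \<gamma>) = 0"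
      using True by algebra
    show ?thesis
      unfolding abc vir_cocycle_LLL idx True cyc
      by (simp only: if_True simp_thms flip: single_add add_divide_distrib) (simp add: 0)
  next
    case False
    then show ?thesis
      unfolding abc vir_cocycle_LLL by (simp add: add_ac)
  qed
next
  case False
  then show ?thesis
    by (cases a; cases b; cases c)
      (simp_all add: bilinear_ext_single_single smult_pm_single)
qed

lemma Lgen_in_sv_basis [simp]: "Lgen \<alpha> i \<in> sv_basis \<Gamma> \<longleftrightarrow> \<alpha> \<in> \<Gamma>"
  and Mgen_in_sv_basis [simp]: "Mgen \<alpha> i \<in> sv_basis \<Gamma> \<longleftrightarrow> \<alpha> \<in> \<Gamma>"
  and Ygen_in_sv_basis [simp]: "Ygen \<alpha> i \<in> sv_basis \<Gamma> \<longleftrightarrow> \<alpha> \<in> \<Gamma>"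
  and Cgen_in_sv_basis [simp]: "Cgen k \<notin> sv_basis \<Gamma>"
  by (auto simp: sv_basis_def)

abbreviation sv_ext_basis :: "'f set \<Rightarrow> 'f sv_gen set" where
  "sv_ext_basis \<Gamma> \<equiv> sv_basis \<Gamma> \<union> range Cgen"

lemma supported_on_zero [simp]: "0 \<in> supported_on B"
  by (simp add: supported_on_def)

lemma supported_on_add: "x \<in> supported_on B \<Longrightarrow> y \<in> supported_on B \<Longrightarrow> x + y \<in> supported_on (B :: 'b set)"
  for x y :: "'b \<Rightarrow>\<^sub>0 'f::field"
  by (rule pm.subspace_add[OF subspace_supported_on])

section \<open>The projection along the central summand\<close>

lemma sv_proj_lookup:
  "Poly_Mapping.lookup (sv_proj \<Gamma> x) b = (if b \<in> sv_basis \<Gamma> then Poly_Mapping.lookup x b else 0)"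
  by (auto simp: sv_proj_def lookup_sum lookup_single when_def in_keys_iff)

lemma sv_proj_add: "sv_proj \<Gamma> (x + y) = sv_proj \<Gamma> x + sv_proj \<Gamma> y"
  and sv_proj_smult: "sv_proj \<Gamma> (smult_pm c x) = smult_pm c (sv_proj \<Gamma> x)"
  by (auto intro!: poly_mapping_eqI simp: sv_proj_lookup lookup_add)

lemma sv_proj_in: "sv_proj \<Gamma> x \<in> supported_on (sv_basis \<Gamma>)"
  by (auto simp: supported_on_def in_keys_iff sv_proj_lookup split: if_splits)

lemma sv_proj_id: "x \<in> supported_on (sv_basis \<Gamma>) \<Longrightarrow> sv_proj \<Gamma> x = x"
  by (rule poly_mapping_eqI) (auto simp: sv_proj_lookup supported_on_def in_keys_iff)

lemma sv_proj_single:
  "sv_proj \<Gamma> (Poly_Mapping.single b k) = (if b \<in> sv_basis \<Gamma> then Poly_Mapping.single b k else 0)"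
  by (rule poly_mapping_eqI) (auto simp: sv_proj_lookup lookup_single when_def)

lemma sv_proj_vir_cocycle: "sv_proj \<Gamma> (vir_cocycle a b) = 0"
  by (cases a; cases b) (auto simp: sv_proj_single, auto intro!: poly_mapping_eqI simp: sv_proj_lookup)

locale sv_data =
  fixes \<Gamma> :: "'f::field_char_0 set" and s :: 'f
  assumes subgroup: "additive_subgroup \<Gamma>"
    and s_notin: "s \<notin> \<Gamma>" and two_s: "2 * s \<in> \<Gamma>"
begin

lemma zero_in [simp]: "0 \<in> \<Gamma>"
  and add_in [simp]: "\<alpha> \<in> \<Gamma> \<Longrightarrow> \<beta> \<in> \<Gamma> \<Longrightarrow> \<alpha> + \<beta> \<in> \<Gamma>"
  and uminus_in [simp]: "\<alpha> \<in> \<Gamma> \<Longrightarrow> - \<alpha> \<in> \<Gamma>"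
  using subgroup by (auto simp: additive_subgroup_def)

lemma diff_in [simp]: "\<alpha> \<in> \<Gamma> \<Longrightarrow> \<beta> \<in> \<Gamma> \<Longrightarrow> \<alpha> - \<beta> \<in> \<Gamma>"
  using add_in[of \<alpha> "- \<beta>"] uminus_in[of \<beta>] by simp

lemma double_in: "\<alpha> \<in> \<Gamma> \<Longrightarrow> 2 * \<alpha> \<in> \<Gamma>"
  using add_in[of \<alpha> \<alpha>] by (simp only: mult_2)

text \<open>Otherwise \<open>s\<close> would be \<open>- \<beta>\<close>, an element of \<Gamma>. So
  division by the weight is always possible for Y.\<close>

lemma Y_weight_nonzero: "\<beta> \<in> \<Gamma> \<Longrightarrow> \<beta> + s \<noteq> 0"
  using s_notin uminus_in[of \<beta>] by (auto simp: add_eq_0_iff)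

lemma sv_bracket_closed: "a \<in> sv_ext_basis \<Gamma> \<Longrightarrow> b \<in> sv_ext_basis \<Gamma> \<Longrightarrow> sv_bracket s a b \<in> supported_on (sv_basis \<Gamma>)"
  using two_s by (cases a; cases b) (auto intro!: supported_on_single)

lemma vir_cocycle_closed: "vir_cocycle a b \<in> supported_on (range Cgen)"
  by (cases a; cases b) (auto intro!: supported_on_single)

lemma lie_algebra_loop_sv: "lie_algebra (loop_sv \<Gamma> s)"
  unfolding loop_sv_def
  by (intro lie_algebra_bilinear_ext sv_jacobi sv_bracket_anti sv_bracket_alt sv_bracket_closed) auto

lemma sv_ext_bracket_closed:
  assumes "a \<in> sv_ext_basis \<Gamma>" "b \<in> sv_ext_basis \<Gamma>"
  shows "sv_ext_bracket s a b \<in> supported_on (sv_ext_basis \<Gamma>)"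
  using sv_bracket_closed[OF assms] vir_cocycle_closed[of a b]
  by (intro supported_on_add) (auto simp: supported_on_def)

lemma lie_algebra_loop_sv_ext: "lie_algebra (loop_sv_ext \<Gamma> s)"
  unfolding loop_sv_ext_def
proof (rule lie_algebra_bilinear_ext)
  fix a b c :: "'f sv_gen"
  show "sv_ext_bracket s a b = - sv_ext_bracket s b a"
    by (subst sv_bracket_anti, subst vir_cocycle_anti) simp
  \<comment> \<open>The central part of the inner bracket is killed, so the Jacobi sum splits into
    the one of \<open>sv_bracket\<close> and the cocycle identity.\<close>
  have 1: "bilinear_ext (sv_ext_bracket s) (Poly_Mapping.single a 1) (sv_ext_bracket s b c) =
      bilinear_ext (sv_bracket s) (Poly_Mapping.single a 1) (sv_bracket s b c)
      + bilinear_ext vir_cocycle (Poly_Mapping.single a 1) (sv_bracket s b c)" for a b c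
    by (simp add: bilinear_ext_plus_bracket bilinear_ext_add_right bilinear_ext_vir_cocycle_right)
  show "bilinear_ext (sv_ext_bracket s) (Poly_Mapping.single a 1) (sv_ext_bracket s b c)
      + bilinear_ext (sv_ext_bracket s) (Poly_Mapping.single b 1) (sv_ext_bracket s c a)
      + bilinear_ext (sv_ext_bracket s) (Poly_Mapping.single c 1) (sv_ext_bracket s a b) = 0"
    using arg_cong2[OF sv_jacobi[of s a b c] vir_cocycle_jacobi[of a s b c], of "(+)"]
    unfolding 1 by (simp only: add_ac add_0_left)
qed (use sv_ext_bracket_closed in \<open>auto simp: sv_bracket_alt vir_cocycle_alt\<close>)

lemma sv_proj_bracket_single:
  assumes "a \<in> sv_ext_basis \<Gamma>" "b \<in> sv_ext_basis \<Gamma>"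
  shows "sv_proj \<Gamma> (sv_ext_bracket s a b) =
    bilinear_ext (sv_bracket s) (sv_proj \<Gamma> (Poly_Mapping.single a 1)) (sv_proj \<Gamma> (Poly_Mapping.single b 1))"
  using sv_proj_id[OF sv_bracket_closed[OF assms]] assms
  by (auto simp: sv_proj_add sv_proj_vir_cocycle sv_proj_single bilinear_ext_single_single)

lemma sv_proj_bracket:
  assumes "x \<in> supported_on (sv_ext_basis \<Gamma>)" "y \<in> supported_on (sv_ext_basis \<Gamma>)"
  shows "sv_proj \<Gamma> (bilinear_ext (sv_ext_bracket s) x y)
    = bilinear_ext (sv_bracket s) (sv_proj \<Gamma> x) (sv_proj \<Gamma> y)"
proof -
  have 1: "Poly_Mapping.single a k = smult_pm k (Poly_Mapping.single a 1)" for a :: "'f sv_gen" and k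
    by (simp add: smult_pm_single)
  have *: "sv_proj \<Gamma> (bilinear_ext (sv_ext_bracket s) (Poly_Mapping.single a k) y)
    = bilinear_ext (sv_bracket s) (sv_proj \<Gamma> (Poly_Mapping.single a k)) (sv_proj \<Gamma> y)"
    if "a \<in> sv_ext_basis \<Gamma>" for a k
    using assms(2)
  proof (induction rule: supported_on_induct)
    case (single b l)
    show ?case
      unfolding 1[of a k] 1[of b l] bilinear_ext_smult_left bilinear_ext_smult_right sv_proj_smult bilinear_ext_single
      by (simp only: sv_proj_bracket_single[OF that single])
  qed (simp_all add: bilinear_ext_add_right sv_proj_add, simp add: sv_proj_def)
  show ?thesis
    using assms(1)
    by (induction rule: supported_on_induct) (simp_all add: bilinear_ext_add_left sv_proj_add *, simp add: sv_proj_def)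
qed

lemma bracket_Cgen_right:
  assumes "z \<in> supported_on (range Cgen)"
  shows "bilinear_ext (sv_ext_bracket s) x z = 0"
  using assms
proof (induction rule: supported_on_induct)
  case (single b k)
  then show ?case
    by (auto simp: bilinear_ext_eq_lin_ext pm.lin_ext_single lin_ext_def)
qed (simp_all add: bilinear_ext_add_right)

lemma central_extension_loop_sv_ext: "central_extension (loop_sv_ext \<Gamma> s) (loop_sv \<Gamma> s) (sv_proj \<Gamma>)"
  unfolding central_extension_def
proof (intro conjI ballI impI)
  show "lie_hom (loop_sv_ext \<Gamma> s) (loop_sv \<Gamma> s) (sv_proj \<Gamma>)"
    by (simp add: lie_hom_def loop_sv_ext_def loop_sv_def sv_proj_in sv_proj_add sv_proj_smult sv_proj_bracket)
  have "supported_on (sv_basis \<Gamma>) \<subseteq> sv_proj \<Gamma> ` supported_on (sv_ext_basis \<Gamma>)"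
  proof
    fix x :: "'f sv_gen \<Rightarrow>\<^sub>0 'f" assume "x \<in> supported_on (sv_basis \<Gamma>)"
    then show "x \<in> sv_proj \<Gamma> ` supported_on (sv_ext_basis \<Gamma>)"
      by (intro image_eqI[of _ _ x]) (auto simp: sv_proj_id supported_on_def)
  qed
  then show "sv_proj \<Gamma> ` lcarrier (loop_sv_ext \<Gamma> s) = lcarrier (loop_sv \<Gamma> s)"
    by (auto simp: loop_sv_ext_def loop_sv_def sv_proj_in)
  fix x z
  assume z: "z \<in> lcarrier (loop_sv_ext \<Gamma> s)" "sv_proj \<Gamma> z = 0"
  \<comment> \<open>A vector of the carrier with zero projection has only \<open>Cgen\<close> keys,
    and those are central.\<close>
  have "Poly_Mapping.lookup z b = 0" if "b \<in> sv_basis \<Gamma>" for b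
    using sv_proj_lookup[of \<Gamma> z b] that z(2) by simp
  then have "z \<in> supported_on (range Cgen)"
    using z(1) by (auto simp: loop_sv_ext_def supported_on_def in_keys_iff)
  then show "lbracket (loop_sv_ext \<Gamma> s) x z = 0"
    by (simp add: loop_sv_ext_def bracket_Cgen_right)
qed (fact lie_algebra_loop_sv_ext lie_algebra_loop_sv)+

end

subsection \<open>Scalar cocycles\<close>

text \<open>The eigenvalue of a basis element under bracketing with \<open>Lgen 0 0\<close>, as
  \<open>sv_bracket_L0\<close> confirms.\<close>

fun sv_weight :: "'f::field \<Rightarrow> 'f sv_gen \<Rightarrow> 'f" where
  "sv_weight s (Lgen \<alpha> i) = \<alpha>"
| "sv_weight s (Mgen \<alpha> i) = \<alpha>"
| "sv_weight s (Ygen \<alpha> i) = \<alpha> + s"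
| "sv_weight s (Cgen k) = 0"

lemma sv_bracket_L0: "sv_bracket s (Lgen 0 0) b = Poly_Mapping.single b (sv_weight s b)"
  and sv_bracket_L0_right: "sv_bracket s b (Lgen 0 0) = Poly_Mapping.single b (- sv_weight s b)"
  by (cases b; simp)+

text \<open>The instance in view is \<open>T a y = l (defect (gen a) y)\<close> with a linear
  functional \<open>l\<close>; the second argument is a vector because the cocycle identity puts
  brackets there. \<open>T_L0\<close> reflects the choice of eigenvectors as lifts, the
  normalizations the brackets that define the images of C, L and M in weight zero.\<close>

locale sv_cocycle = sv_data \<Gamma> s for \<Gamma> :: "'f::field_char_0 set" and s +
  fixes T :: "'f sv_gen \<Rightarrow> ('f sv_gen \<Rightarrow>\<^sub>0 'f) \<Rightarrow> 'f" and e :: 'f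
  assumes e: "e \<in> \<Gamma>" "e \<noteq> 0"
    and T_add: "T a (x + y) = T a x + T a y"
    and T_smult: "T a (smult_pm k x) = k * T a x"
    and T_anti: "T b (Poly_Mapping.single a 1) = - T a (Poly_Mapping.single b 1)"
    and T_Cgen: "T a (Poly_Mapping.single (Cgen n) 1) = 0"
    and T_jacobi: "a \<in> sv_basis \<Gamma> \<Longrightarrow> b \<in> sv_basis \<Gamma> \<Longrightarrow> c \<in> sv_basis \<Gamma> \<Longrightarrow>
      T a (sv_ext_bracket s b c) + T b (sv_ext_bracket s c a) + T c (sv_ext_bracket s a b) = 0"
    and T_L0: "b \<in> sv_basis \<Gamma> \<Longrightarrow> T (Lgen 0 0) (Poly_Mapping.single b 1) = 0"
    and T_LL_normalized: "T (Lgen (- e) 0) (Poly_Mapping.single (Lgen e n) 1) = 0"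
      "T (Lgen (- 2 * e) 0) (Poly_Mapping.single (Lgen (2 * e) n) 1) = 0"
    and T_LM_normalized: "T (Lgen (- e) 0) (Poly_Mapping.single (Mgen e n) 1) = 0"
begin

definition t :: "'f sv_gen \<Rightarrow> 'f sv_gen \<Rightarrow> 'f" where
  "t a b = T a (Poly_Mapping.single b 1)"

lemma T_single: "T a (Poly_Mapping.single b k) = k * t a b"
  using T_smult[of a k "Poly_Mapping.single b 1"] by (simp add: smult_pm_single t_def)

lemma T_zero: "T a 0 = 0"
  using T_single[of a undefined 0] by simp

lemma T_vir_cocycle: "T a (vir_cocycle b c) = 0"
  by (cases b; cases c) (simp_all add: T_zero T_single T_Cgen[folded t_def])

lemma T_sv_jacobi:
  assumes "a \<in> sv_basis \<Gamma>" "b \<in> sv_basis \<Gamma>" "c \<in> sv_basis \<Gamma>"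
  shows "T a (sv_bracket s b c) + T b (sv_bracket s c a) + T c (sv_bracket s a b) = 0"
  using T_jacobi[OF assms] by (simp add: T_add T_vir_cocycle)

lemma t_anti: "t b a = - t a b"
  unfolding t_def by (rule T_anti)

text \<open>In the cocycle identity for \<open>Lgen 0 0\<close>, \<open>a\<close>, \<open>b\<close>
  the term with \<open>Lgen 0 0\<close> outside vanishes by \<open>T_L0\<close>; the other two add
  up to minus the total weight times \<open>t a b\<close>.\<close>

lemma t_weight:
  assumes "a \<in> sv_basis \<Gamma>" "b \<in> sv_basis \<Gamma>" "sv_weight s a + sv_weight s b \<noteq> 0"
  shows "t a b = 0"
proof -
  have "T (Lgen 0 0) (sv_bracket s a b) = 0"
  proof -
    have L0: "T (Lgen 0 0) x = 0" if "x \<in> supported_on (sv_basis \<Gamma>)" for x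
      using that by (induction rule: supported_on_induct) (auto simp: T_zero T_add T_single T_L0[folded t_def])
    show ?thesis
      using assms by (intro L0 sv_bracket_closed) auto
  qed
  moreover have "T a (sv_bracket s b (Lgen 0 0)) = - sv_weight s b * t a b"
    "T b (sv_bracket s (Lgen 0 0) a) = - sv_weight s a * t a b"
    using t_anti[of b a] by (simp_all add: sv_bracket_L0 sv_bracket_L0_right T_single)
  ultimately have "(sv_weight s a + sv_weight s b) * t a b = 0"
    using T_sv_jacobi[OF _ assms(1,2), of "Lgen 0 0"] by simp algebra
  with assms(3) show ?thesis by simp
qed

section \<open>The cocycle identity at the triples LLL, LLM, LYY and MYY\<close>

lemma LLL:
  assumes "\<alpha> \<in> \<Gamma>" "\<beta> \<in> \<Gamma>" "\<gamma> \<in> \<Gamma>"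
  shows "(\<gamma> - \<beta>) * t (Lgen \<alpha> i) (Lgen (\<beta> + \<gamma>) (j + k))
    + (\<alpha> - \<gamma>) * t (Lgen \<beta> j) (Lgen (\<gamma> + \<alpha>) (k + i))
    + (\<beta> - \<alpha>) * t (Lgen \<gamma> k) (Lgen (\<alpha> + \<beta>) (i + j)) = 0"
  using T_sv_jacobi[of "Lgen \<alpha> i" "Lgen \<beta> j" "Lgen \<gamma> k"] assms by (simp add: T_single)

lemma LLM:
  assumes "\<alpha> \<in> \<Gamma>" "\<beta> \<in> \<Gamma>" "\<gamma> \<in> \<Gamma>"
  shows "\<gamma> * t (Lgen \<alpha> i) (Mgen (\<beta> + \<gamma>) (j + k))
    - \<gamma> * t (Lgen \<beta> j) (Mgen (\<alpha> + \<gamma>) (i + k))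
    - (\<beta> - \<alpha>) * t (Lgen (\<alpha> + \<beta>) (i + j)) (Mgen \<gamma> k) = 0"
  using T_sv_jacobi[of "Lgen \<alpha> i" "Lgen \<beta> j" "Mgen \<gamma> k"] assms
    t_anti[of "Mgen \<gamma> k" "Lgen (\<alpha> + \<beta>) (i + j)"] by (simp add: T_single)

lemma LYY:
  assumes "\<alpha> \<in> \<Gamma>" "\<beta> \<in> \<Gamma>" "\<gamma> \<in> \<Gamma>"
  shows "(\<gamma> - \<beta>) * t (Lgen \<alpha> i) (Mgen (\<beta> + \<gamma> + 2 * s) (j + k))
    - (\<gamma> + s - \<alpha> / 2) * t (Ygen \<beta> j) (Ygen (\<alpha> + \<gamma>) (i + k))
    + (\<beta> + s - \<alpha> / 2) * t (Ygen \<gamma> k) (Ygen (\<alpha> + \<beta>) (i + j)) = 0"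
  using T_sv_jacobi[of "Lgen \<alpha> i" "Ygen \<beta> j" "Ygen \<gamma> k"] assms by (simp add: T_single algebra_simps)

lemma MYY:
  assumes "\<alpha> \<in> \<Gamma>" "\<beta> \<in> \<Gamma>" "\<gamma> \<in> \<Gamma>" "\<beta> \<noteq> \<gamma>"
  shows "t (Mgen \<alpha> i) (Mgen (\<beta> + \<gamma> + 2 * s) (j + k)) = 0"
  using T_sv_jacobi[of "Mgen \<alpha> i" "Ygen \<beta> j" "Ygen \<gamma> k"] assms
  by (simp add: T_single T_zero)

text \<open>The value depends only on \<alpha> and \<open>i + j\<close>, and satisfies the recursion
  \<open>rec\<close>. Both \<open>\<alpha>\<close> and \<open>\<alpha> ^ 3\<close> solve that
  recursion, hence the two normalizations at \<open>e\<close> and \<open>2 * e\<close>.\<close>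

lemma LL_zero_weight:
  assumes "\<alpha> \<in> \<Gamma>"
  shows "t (Lgen \<alpha> i) (Lgen (- \<alpha>) j) = 0"
proof -
  define a where "a n \<alpha> = t (Lgen \<alpha> 0) (Lgen (- \<alpha>) n)" for n \<alpha>
  \<comment> \<open>Two equal weights make the third coefficient zero; the others are
    \<open>- 3 * \<alpha>\<close> and \<open>3 * \<alpha>\<close>.\<close>
  have shift: "t (Lgen \<alpha> i) (Lgen (- \<alpha>) j) = a (i + j) \<alpha>" if "\<alpha> \<in> \<Gamma>" "\<alpha> \<noteq> 0" for \<alpha> i j
    using LLL[of \<alpha> \<alpha> "- 2 * \<alpha>" i 0 j] that double_in[of \<alpha>] uminus_in[of "2 * \<alpha>"]
    by (simp add: a_def algebra_simps)
  \<comment> \<open>The other two values are \<open>a (i + j) e\<close> with opposite signs and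
    cancel.\<close>
  have zero: "t (Lgen 0 i) (Lgen 0 j) = 0" for i j
    using LLL[of 0 e "- e" i 0 j] e shift[of e] shift[of "- e"]
      t_anti[of "Lgen (- e) j" "Lgen e i"]
    by (simp add: algebra_simps)
  have odd: "a n (- \<alpha>) = - a n \<alpha>" if "\<alpha> \<in> \<Gamma>" for n \<alpha>
  proof (cases "\<alpha> = 0")
    case True
    then show ?thesis by (simp add: a_def zero)
  next
    case False
    then show ?thesis
      using that shift[of \<alpha> n 0] t_anti[of "Lgen (-\<alpha>) 0" "Lgen \<alpha> n"] by (simp add: a_def)
  qed
  have shift': "t (Lgen \<alpha> i) (Lgen (- \<alpha>) j) = a (i + j) \<alpha>" if "\<alpha> \<in> \<Gamma>" for \<alpha> i j
    using shift[OF that] zero by (cases "\<alpha> = 0") (simp_all add: a_def)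
  have rec: "(\<alpha> - \<beta>) * a n (\<alpha> + \<beta>) = (\<alpha> + 2 * \<beta>) * a n \<alpha> - (2 * \<alpha> + \<beta>) * a n \<beta>"
    if "\<alpha> \<in> \<Gamma>" "\<beta> \<in> \<Gamma>" for \<alpha> \<beta> n
  proof -
    have eq: "\<beta> + - (\<alpha> + \<beta>) = - \<alpha>" "- (\<alpha> + \<beta>) + \<alpha> = - \<beta>"
      by simp_all
    have mem: "- (\<alpha> + \<beta>) \<in> \<Gamma>"
      using that by simp
    have "(- (\<alpha> + \<beta>) - \<beta>) * a n \<alpha> + (\<alpha> - - (\<alpha> + \<beta>)) * a n \<beta> + (\<beta> - \<alpha>) * a n (- (\<alpha> + \<beta>)) = 0"
      using LLL[OF that mem, of 0 0 n, unfolded eq] shift'[of "- (\<alpha> + \<beta>)" n 0, OF mem, unfolded minus_minus]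
      unfolding a_def add_0_left add_0_right by simp
    then show ?thesis
      using odd[of "\<alpha> + \<beta>" n] that by (simp add: algebra_simps)
  qed
  have ae: "a n e = 0" "a n (2 * e) = 0" for n
    using odd[of "- e" n] odd[of "- (2 * e)" n] T_LL_normalized[of n] e double_in[of e]
    by (simp_all add: a_def t_def)
  have "a n \<alpha> = 0" for n
  proof -
    \<comment> \<open>\<open>\<alpha> + 2 * e\<close> is reached from \<alpha> by two steps of
      \<open>e\<close> or one of \<open>2 * e\<close>. Eliminating the intermediate values leaves
      \<open>12 * e ^ 3\<close>, free of \<alpha>, as the coefficient of
      \<open>a n \<alpha>\<close>.\<close>
    have r1: "(\<alpha> - e) * a n (\<alpha> + e) = (\<alpha> + 2 * e) * a n \<alpha>"
      using rec[OF assms e(1), of n] ae by simp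
    have r2: "(\<alpha> - 2 * e) * a n (\<alpha> + 2 * e) = (\<alpha> + 4 * e) * a n \<alpha>"
      using rec[OF assms double_in[OF e(1)], of n] ae by simp
    have r3: "\<alpha> * a n (\<alpha> + 2 * e) = (\<alpha> + 3 * e) * a n (\<alpha> + e)"
      using rec[OF add_in[OF assms e(1)] e(1), of n] ae by (simp add: algebra_simps)
    have "12 * e ^ 3 * a n \<alpha> = 0"
      using r1 r2 r3 by algebra
    then show ?thesis using e by simp
  qed
  then show ?thesis
    using shift'[OF assms] by simp
qed

text \<open>Writing \<open>f\<close> and \<open>g\<close> for the values on pairs \<open>(Y, Y)\<close> and \<open>(L, M)\<close> of total weight zero, the
  triple of weights \<open>(2u, u, -3u)\<close> gives \<open>f u = g (2u)\<close>; so everything reduces to \<open>g = 0\<close>.\<close>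

lemma
  shows LM_zero_weight: "\<alpha> \<in> \<Gamma> \<Longrightarrow> t (Lgen \<alpha> i) (Mgen (- \<alpha>) j) = 0"
    and YY_zero_weight: "\<beta> \<in> \<Gamma> \<Longrightarrow> t (Ygen \<beta> i) (Ygen (- \<beta> - 2 * s) j) = 0"
proof -
  define f where "f n \<beta> = t (Ygen \<beta> 0) (Ygen (- \<beta> - 2 * s) n)" for n \<beta>
  define g where "g n \<alpha> = t (Lgen \<alpha> 0) (Mgen (- \<alpha>) n)" for n \<alpha>
  have f: "t (Ygen \<beta> i) (Ygen (- \<beta> - 2 * s) j) = f (i + j) \<beta>" if "\<beta> \<in> \<Gamma>" for \<beta> i j
  proof -
    \<comment> \<open>Equal Y subscripts remove the (L, M) term from \<open>LYY\<close>, and the L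
      subscript makes the total weight zero. The common coefficient left over is
      \<open>2 * (\<beta> + s)\<close> up to sign, which is nonzero.\<close>
    have eq: "- (2 * \<beta> + 2 * s) + \<beta> = - \<beta> - 2 * s" "\<beta> + s - - (2 * \<beta> + 2 * s) / 2 = 2 * (\<beta> + s)"
      by (simp_all add: field_simps)
    have "2 * \<beta> + 2 * s \<noteq> 0"
      using Y_weight_nonzero[OF that] by (metis distrib_left mult_eq_0_iff zero_neq_numeral)
    moreover have "- (2 * \<beta> + 2 * s) \<in> \<Gamma>"
      using that two_s double_in[OF that] by simp
    ultimately show ?thesis
      using LYY[OF _ that that, of "- (2 * \<beta> + 2 * s)" j i 0, unfolded eq] Y_weight_nonzero[OF that]
      by (simp add: f_def add.commute)
  qed
  have LYY': "(\<gamma> - \<beta>) * t (Lgen \<alpha> i) (Mgen (- \<alpha>) j)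
    = (\<gamma> + s - \<alpha> / 2) * f (i + j) \<beta> - (\<beta> + s - \<alpha> / 2) * f (i + j) \<gamma>"
    if "\<beta> \<in> \<Gamma>" "\<gamma> \<in> \<Gamma>" "\<alpha> = - \<beta> - \<gamma> - 2 * s" for \<alpha> \<beta> \<gamma> i j
  proof -
    have eq: "\<beta> + \<gamma> + 2 * s = - \<alpha>" "\<alpha> + \<gamma> = - \<beta> - 2 * s" "\<alpha> + \<beta> = - \<gamma> - 2 * s"
      using that(3) by simp_all
    have "\<alpha> \<in> \<Gamma>"
      using that two_s by simp
    from LYY[OF this that(1,2), of i j 0, unfolded eq f[OF that(1)] f[OF that(2)]] show ?thesis
      by (simp add: add.commute[of j i] algebra_simps)
  qed
  \<comment> \<open>Distinct \<beta> and \<gamma> make the coefficient of the (L, M) value in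
    \<open>LYY'\<close> nonzero. Taking \<open>\<gamma> = 0\<close> works unless \<beta> becomes 0
    too; then \<open>e\<close> and \<open>- e\<close> serve.\<close>
  have ex: "\<exists>\<beta> \<gamma>. \<beta> \<in> \<Gamma> \<and> \<gamma> \<in> \<Gamma> \<and> \<beta> \<noteq> \<gamma> \<and> \<alpha> = - \<beta> - \<gamma> - 2 * s" if "\<alpha> \<in> \<Gamma>" for \<alpha>
  proof (cases "- \<alpha> - 2 * s = 0")
    case True
    then have "\<alpha> = - e - - e - 2 * s"
      by algebra
    moreover have "e \<noteq> - e"
      using e(2) by (simp add: eq_neg_iff_add_eq_0 flip: mult_2)
    ultimately show ?thesis
      using e(1) uminus_in by blast
  next
    case False
    then show ?thesis
      using that two_s by (intro exI[of _ "- \<alpha> - 2 * s"] exI[of _ 0]) auto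
  qed
  have g: "t (Lgen \<alpha> i) (Mgen (- \<alpha>) j) = g (i + j) \<alpha>" if \<alpha>: "\<alpha> \<in> \<Gamma>" for \<alpha> i j
  proof -
    from ex[OF \<alpha>] obtain \<beta> \<gamma> where bc: "\<beta> \<in> \<Gamma>" "\<gamma> \<in> \<Gamma>" "\<beta> \<noteq> \<gamma>" "\<alpha> = - \<beta> - \<gamma> - 2 * s"
      by blast
    have "(\<gamma> - \<beta>) * t (Lgen \<alpha> i) (Mgen (- \<alpha>) j) = (\<gamma> - \<beta>) * g (i + j) \<alpha>"
      using LYY'[OF bc(1,2,4), of i j] LYY'[OF bc(1,2,4), of 0 "i + j"] by (simp add: g_def)
    with bc(3) show ?thesis by simp
  qed
  have fg: "(\<gamma> - \<beta>) * g n \<alpha> = (\<gamma> + s - \<alpha> / 2) * f n \<beta> - (\<beta> + s - \<alpha> / 2) * f n \<gamma>"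
    if "\<beta> \<in> \<Gamma>" "\<gamma> \<in> \<Gamma>" "\<alpha> = - \<beta> - \<gamma> - 2 * s" for \<alpha> \<beta> \<gamma> n
    using LYY'[OF that, of 0 n] by (simp add: g_def)
  have f_odd: "f n (- \<beta> - 2 * s) = - f n \<beta>" if "\<beta> \<in> \<Gamma>" for n \<beta>
    using f[OF that, of n 0] t_anti[of "Ygen (- \<beta> - 2 * s) 0" "Ygen \<beta> n"] by (simp add: f_def)
  \<comment> \<open>L and M being of different kinds, \<open>t_anti\<close> alone does not give
    this. The sign comes from reflecting each Y subscript \<beta> to
    \<open>- \<beta> - 2 * s\<close>, under which \<open>f\<close> is odd.\<close>
  have g_odd: "g n (- \<alpha>) = - g n \<alpha>" if \<alpha>: "\<alpha> \<in> \<Gamma>" for n \<alpha>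
  proof -
    from ex[OF \<alpha>] obtain \<beta> \<gamma> where bc: "\<beta> \<in> \<Gamma>" "\<gamma> \<in> \<Gamma>" "\<beta> \<noteq> \<gamma>" "\<alpha> = - \<beta> - \<gamma> - 2 * s"
      by blast
    have mem: "- \<beta> - 2 * s \<in> \<Gamma>" "- \<gamma> - 2 * s \<in> \<Gamma>"
      using bc two_s by simp_all
    have eq: "- \<alpha> = - (- \<beta> - 2 * s) - (- \<gamma> - 2 * s) - 2 * s"
      "- \<gamma> - 2 * s - (- \<beta> - 2 * s) = \<beta> - \<gamma>"
      using bc(4) by simp_all
    have eq': "- \<gamma> - 2 * s + s - - \<alpha> / 2 = - (\<gamma> + s - \<alpha> / 2)"
      "- \<beta> - 2 * s + s - - \<alpha> / 2 = - (\<beta> + s - \<alpha> / 2)"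
      by simp_all
    have "(\<beta> - \<gamma>) * g n (- \<alpha>) = (\<gamma> + s - \<alpha> / 2) * f n \<beta> - (\<beta> + s - \<alpha> / 2) * f n \<gamma>"
      using fg[OF mem eq(1), of n] unfolding eq(2) eq' f_odd[OF bc(1)] f_odd[OF bc(2)] by (simp only: minus_mult_minus)
    also have "\<dots> = (\<beta> - \<gamma>) * - g n \<alpha>"
      using fg[OF bc(1,2,4), of n] by (simp add: algebra_simps)
    finally show ?thesis using bc(3) by (simp only: mult_cancel_left right_minus_eq simp_thms)
  qed
  have g_e: "g n e = 0" for n
    using g_odd[OF e(1), of n] g[of "- e" 0 n] T_LM_normalized[of n] e by (simp add: t_def)
  have rec: "(\<alpha> + \<beta>) * (g n \<alpha> - g n \<beta>) = (\<alpha> - \<beta>) * g n (\<alpha> + \<beta>)" if "\<alpha> \<in> \<Gamma>" "\<beta> \<in> \<Gamma>" for \<alpha> \<beta> n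
  proof -
    have eq: "\<beta> + - (\<alpha> + \<beta>) = - \<alpha>" "\<alpha> + - (\<alpha> + \<beta>) = - \<beta>"
      by simp_all
    have "- (\<alpha> + \<beta>) \<in> \<Gamma>"
      using that by simp
    from LLM[OF that this, of 0 0 n, unfolded eq] show ?thesis
      unfolding g_def add_0_left by algebra
  qed
  have g0: "g n \<alpha> = 0" if "\<alpha> \<in> \<Gamma>" for n \<alpha>
  proof -
    \<comment> \<open>A step up by \<open>e\<close> and a step back down return to \<alpha>. Since
      \<open>g\<close> vanishes at \<open>e\<close> and \<open>- e\<close>, comparing the
      coefficients leaves the constant \<open>2 * e ^ 2\<close>.\<close>
    have "(\<alpha> + e) * g n \<alpha> = (\<alpha> - e) * g n (\<alpha> + e)"
      using rec[OF that e(1), of n] g_e by simp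
    moreover have "\<alpha> * g n (\<alpha> + e) = (\<alpha> + 2 * e) * g n \<alpha>"
      using rec[of "\<alpha> + e" "- e" n] that e g_odd[OF e(1), of n] g_e by (simp add: algebra_simps)
    ultimately have "2 * e ^ 2 * g n \<alpha> = 0"
      by algebra
    then show ?thesis using e by simp
  qed
  have f0: "f n \<beta> = 0" if "\<beta> \<in> \<Gamma>" for n \<beta>
  proof -
    \<comment> \<open>With u = \<beta> + s this is the subscript of weight -3u. Next to an L of
      weight 2u, the coefficient of its \<open>f\<close> value is u - (2u)/2 = 0.\<close>
    have "- 3 * \<beta> - 4 * s = - (2 * \<beta>) - \<beta> - 2 * (2 * s)"
      by simp
    also have "\<dots> \<in> \<Gamma>"
      using that two_s double_in[OF that] double_in[OF two_s] by (simp only: diff_in uminus_in)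
    finally have mem: "- 3 * \<beta> - 4 * s \<in> \<Gamma>" .
    have "2 * \<beta> + 2 * s \<in> \<Gamma>"
      using that two_s double_in by simp
    note g0 = g0[OF this]
    have eq: "2 * \<beta> + 2 * s = - \<beta> - (- 3 * \<beta> - 4 * s) - 2 * s"
      by simp
    have eq': "- 3 * \<beta> - 4 * s + s - (2 * \<beta> + 2 * s) / 2 = - 4 * (\<beta> + s)"
      "\<beta> + s - (2 * \<beta> + 2 * s) / 2 = 0"
      by (simp_all add: field_simps)
    have "- 4 * (\<beta> + s) * f n \<beta> = 0"
      using fg[OF that mem eq, of n] unfolding g0 eq' by simp
    then show ?thesis
      using Y_weight_nonzero[OF that] by (simp del: mult_minus_left add: eq_neg_iff_add_eq_0 neg_eq_iff_add_eq_0)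
  qed
  show "\<alpha> \<in> \<Gamma> \<Longrightarrow> t (Lgen \<alpha> i) (Mgen (- \<alpha>) j) = 0"
    by (simp add: g g0)
  show "\<beta> \<in> \<Gamma> \<Longrightarrow> t (Ygen \<beta> i) (Ygen (- \<beta> - 2 * s) j) = 0"
    by (simp add: f f0)
qed

text \<open>Each M is, up to a nonzero factor, a bracket of two Y's with distinct subscripts, so
  \<open>MYY\<close> applies. The choice \<open>\<beta> - 2 * s\<close> and 0 degenerates for
  \<open>\<beta> = 2 * s\<close>, where \<open>e\<close> and \<open>- e\<close> replace it.\<close>

lemma MM_vanishes:
  assumes "\<alpha> \<in> \<Gamma>" "\<beta> \<in> \<Gamma>"
  shows "t (Mgen \<alpha> i) (Mgen \<beta> j) = 0"
proof (cases "\<beta> = 2 * s")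
  case True
  then show ?thesis
    using MYY[OF assms(1) e(1) uminus_in[OF e(1)], of i j 0] e by simp
next
  case False
  then show ?thesis
    using MYY[OF assms(1), of "\<beta> - 2 * s" 0 i j 0] assms two_s by simp
qed

lemma t_vanishes:
  assumes ab: "a \<in> sv_basis \<Gamma>" "b \<in> sv_basis \<Gamma>"
  shows "t a b = 0"
proof (cases "sv_weight s a + sv_weight s b = 0")
  case False
  then show ?thesis by (rule t_weight[OF ab])
next
  case True
  \<comment> \<open>An L or M together with a Y never has total weight zero, which excludes the
    mixed cases.\<close>
  have LY: "\<alpha> + (\<beta> + s) \<noteq> 0" if "\<alpha> \<in> \<Gamma>" "\<beta> \<in> \<Gamma>" for \<alpha> \<beta>
    using Y_weight_nonzero[of "\<alpha> + \<beta>"] that by (simp add: add.assoc)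
  have LM: "t (Lgen \<alpha> i) (Mgen \<beta> j) = 0" if "\<alpha> \<in> \<Gamma>" "\<alpha> + \<beta> = 0" for \<alpha> \<beta> i j
    using LM_zero_weight[OF that(1)] that(2) by (metis add_eq_0_iff)
  show ?thesis
  proof (cases a)
    case a: (Lgen \<alpha> i)
    show ?thesis
    proof (cases b)
      case (Lgen \<beta> j)
      then show ?thesis
        using a ab True LL_zero_weight[of \<alpha> i j] by (simp add: add_eq_0_iff)
    qed (use a ab True LM LY in auto)
  next
    case a: (Mgen \<alpha> i)
    show ?thesis
    proof (cases b)
      case (Lgen \<beta> j)
      then show ?thesis
        using a ab True LM[of \<beta> \<alpha> j i] t_anti[of a b] by (simp add: add.commute)
    qed (use a ab True MM_vanishes LY in auto)
  next
    case a: (Ygen \<alpha> i)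
    show ?thesis
    proof (cases b)
      case (Ygen \<beta> j)
      then have "\<beta> = - \<alpha> - 2 * s"
        using True a by (simp add: algebra_simps add_eq_0_iff)
      then show ?thesis
        using a ab Ygen YY_zero_weight[of \<alpha> i j] by simp
    qed (use a ab True LY in \<open>auto simp: add.commute\<close>)
  qed (use ab in simp)
qed

end

subsection \<open>Lifting to an arbitrary central extension\<close>

text \<open>A nonzero vector is linearly independent, so a functional can be prescribed on it. This
  turns cocycles with values in \<open>X\<close> into scalar ones.\<close>

lemma (in vector_space) ex_linear_functional:
  assumes "v \<noteq> 0"
  shows "\<exists>l. Vector_Spaces.linear scale (*) l \<and> l v \<noteq> 0"
proof -
  interpret vector_space_pair scale "(*)"
    by unfold_locales (auto simp: algebra_simps)
  obtain l where "Vector_Spaces.linear scale (*) l" "\<forall>x\<in>{v}. l x = 1"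
    using linear_independent_extend[of "{v}" "\<lambda>_. 1"] assms by auto
  then show ?thesis by force
qed

locale sv_central_extension = sv_data \<Gamma> s for \<Gamma> :: "'f::field_char_0 set" and s +
  fixes X :: "('f, 'x::ab_group_add) lie_struct" and q :: "'x \<Rightarrow> 'f sv_gen \<Rightarrow>\<^sub>0 'f"
  assumes central: "central_extension X (loop_sv \<Gamma> s) q"
begin

abbreviation "car \<equiv> lcarrier X"
abbreviation "sc \<equiv> lscale X"
abbreviation "br \<equiv> lbracket X"
abbreviation "E_br \<equiv> bilinear_ext (sv_ext_bracket s)"
abbreviation gen :: "'f sv_gen \<Rightarrow> 'f sv_gen \<Rightarrow>\<^sub>0 'f" where "gen b \<equiv> Poly_Mapping.single b 1"

section \<open>Calculus in the central extension \<open>X\<close>\<close>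

lemma lie_X: "lie_algebra X"
  using central by (simp add: central_extension_def)

sublocale X: vector_space "lscale X"
  using lie_X by (simp add: lie_algebra_def)

lemma subspace_car: "X.subspace car"
  using lie_X by (simp add: lie_algebra_def)

lemmas car_zero [simp] = X.subspace_0[OF subspace_car]
  and car_add [simp] = X.subspace_add[OF subspace_car]
  and car_diff [simp] = X.subspace_diff[OF subspace_car]
  and car_scale [simp] = X.subspace_scale[OF subspace_car]

lemma br_closed [simp]: "x \<in> car \<Longrightarrow> y \<in> car \<Longrightarrow> br x y \<in> car"
  and br_add_left: "x \<in> car \<Longrightarrow> y \<in> car \<Longrightarrow> z \<in> car \<Longrightarrow> br (x + y) z = br x z + br y z"
  and br_add_right: "x \<in> car \<Longrightarrow> y \<in> car \<Longrightarrow> z \<in> car \<Longrightarrow> br z (x + y) = br z x + br z y"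
  and br_scale_left: "x \<in> car \<Longrightarrow> y \<in> car \<Longrightarrow> br (sc c x) y = sc c (br x y)"
  and br_scale_right: "x \<in> car \<Longrightarrow> y \<in> car \<Longrightarrow> br x (sc c y) = sc c (br x y)"
  and br_self: "x \<in> car \<Longrightarrow> br x x = 0"
  and br_jacobi: "x \<in> car \<Longrightarrow> y \<in> car \<Longrightarrow> z \<in> car \<Longrightarrow>
    br x (br y z) + br y (br z x) + br z (br x y) = 0"
  using lie_X unfolding lie_algebra_def by blast+

lemma br_anti:
  assumes "x \<in> car" "y \<in> car"
  shows "br x y = - br y x"
proof -
  have "br (x + y) (x + y) = br x x + br x y + (br y x + br y y)"
    using assms by (simp add: br_add_left br_add_right)
  then show ?thesis
    using assms by (simp add: br_self eq_neg_iff_add_eq_0)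
qed

lemma q_add: "x \<in> car \<Longrightarrow> y \<in> car \<Longrightarrow> q (x + y) = q x + q y"
  and q_scale: "x \<in> car \<Longrightarrow> q (sc c x) = smult_pm c (q x)"
  and q_br: "x \<in> car \<Longrightarrow> y \<in> car \<Longrightarrow> q (br x y) = bilinear_ext (sv_bracket s) (q x) (q y)"
  using central by (simp_all add: central_extension_def lie_hom_def loop_sv_def)

lemma q_zero: "q 0 = 0"
  using q_add[of 0 0] by simp

lemma q_diff: "x \<in> car \<Longrightarrow> y \<in> car \<Longrightarrow> q (x - y) = q x - q y"
  using q_add[of "x - y" y] by simp

lemma br_central: "x \<in> car \<Longrightarrow> z \<in> car \<Longrightarrow> q z = 0 \<Longrightarrow> br x z = 0"
  using central by (simp add: central_extension_def)

lemma br_cong_right: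
  assumes "x \<in> car" "y \<in> car" "y' \<in> car" "q y = q y'"
  shows "br x y = br x y'"
  using br_central[of x "y - y'"] br_add_right[of "y - y'" y' x] assms by (simp add: q_diff)

text \<open>Elements with the same image under \<open>q\<close> differ by a central one, so brackets
  in \<open>X\<close> do not depend on the lifts chosen.\<close>

lemma br_cong:
  assumes "x \<in> car" "x' \<in> car" "y \<in> car" "y' \<in> car" "q x = q x'" "q y = q y'"
  shows "br x y = br x' y'"
  by (metis assms br_anti br_cong_right)

section \<open>Lifts of basis elements and eigenvectors of \<open>D\<close>\<close>

definition lift :: "'f sv_gen \<Rightarrow> 'x" where
  "lift b = (SOME x. x \<in> car \<and> q x = gen b)"

lemma lift:
  assumes "b \<in> sv_basis \<Gamma>"
  shows "lift b \<in> car" "q (lift b) = gen b"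
proof -
  have "gen b \<in> q ` car"
    using central assms by (simp add: central_extension_def loop_sv_def supported_on_single)
  then have "\<exists>x. x \<in> car \<and> q x = gen b"
    by force
  from someI_ex[OF this] show "lift b \<in> car" "q (lift b) = gen b"
    by (simp_all add: lift_def)
qed

abbreviation "D \<equiv> lift (Lgen 0 0)"

lemma D: "D \<in> car" "q D = gen (Lgen 0 0)"
  by (simp_all add: lift)

definition eigenlift :: "'f sv_gen \<Rightarrow> 'x" where
  "eigenlift b = sc (inverse (sv_weight s b)) (br D (lift b))"

text \<open>\<open>D\<close> acts alike on \<open>eigenlift b\<close> and \<open>lift b\<close>,
  which have the same image under \<open>q\<close>; and \<open>br D (lift b)\<close> is by
  construction the weight times \<open>eigenlift b\<close>.\<close>

lemma eigenlift:
  assumes "b \<in> sv_basis \<Gamma>" "sv_weight s b \<noteq> 0"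
  shows "eigenlift b \<in> car" "q (eigenlift b) = gen b"
    "br D (eigenlift b) = sc (sv_weight s b) (eigenlift b)"
proof -
  show 1: "eigenlift b \<in> car"
    using assms by (simp add: eigenlift_def lift)
  show 2: "q (eigenlift b) = gen b"
    using assms by (simp add: eigenlift_def lift q_scale q_br bilinear_ext_single sv_bracket_L0 smult_pm_single)
  have "br D (eigenlift b) = br D (lift b)"
    using assms 1 2 by (intro br_cong) (simp_all add: lift)
  then show "br D (eigenlift b) = sc (sv_weight s b) (eigenlift b)"
    using assms by (simp add: eigenlift_def)
qed

text \<open>By the Jacobi identity, bracketing with \<open>D\<close> is a derivation, so eigenvalues
  add.\<close>

lemma br_D_br:
  assumes "x \<in> car" "y \<in> car" "br D x = sc a x" "br D y = sc b y"
  shows "br D (br x y) = sc (a + b) (br x y)"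
proof -
  have "br x (br y D) = - sc b (br x y)"
    using assms br_anti[of y D] br_scale_right[of x y "- b"] D by simp
  moreover have "br y (br D x) = - sc a (br x y)"
    using assms br_anti[of y x] by (simp add: br_scale_right)
  ultimately show ?thesis
    using br_jacobi[of D x y] assms D by (simp add: X.scale_left_distrib algebra_simps)
qed

text \<open>A nonzero element of \<Gamma> is wanted; \<open>2 * s\<close> is one because 0 \<in>
  \<Gamma> and s \<notin> \<Gamma>.\<close>

definition e :: 'f where "e = 2 * s"

lemma e [simp]: "e \<in> \<Gamma>" "e \<noteq> 0"
  using two_s s_notin zero_in by (auto simp: e_def)

lemma two_e [simp]: "2 * e \<in> \<Gamma>"
  by (rule double_in[OF e(1)])

text \<open>In the extension, \<open>[L\<^sub>-\<^sub>\<alpha>, L\<^sub>\<alpha>] = 2 \<alpha> L\<^sub>0 + ((\<alpha> - \<alpha>\<^sup>3) / 12) C\<close>; the images of \<open>C\<close> and \<open>L\<^sub>0\<close> are found by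
  solving this for \<open>\<alpha> = e\<close> and \<open>\<alpha> = 2 e\<close>.\<close>

definition P1 :: "int \<Rightarrow> 'x" where
  "P1 n = br (eigenlift (Lgen (- e) 0)) (eigenlift (Lgen e n))"

definition P2 :: "int \<Rightarrow> 'x" where
  "P2 n = br (eigenlift (Lgen (- 2 * e) 0)) (eigenlift (Lgen (2 * e) n))"

text \<open>In twice \<open>P1 n\<close> minus \<open>P2 n\<close> the L parts cancel, and
  \<open>e ^ 3 / 2\<close> times the image of C remains.\<close>

definition imgC :: "int \<Rightarrow> 'x" where
  "imgC n = sc (2 / e ^ 3) (sc 2 (P1 n) - P2 n)"

definition imgL0 :: "int \<Rightarrow> 'x" where
  "imgL0 n = sc (1 / (2 * e)) (P1 n - sc ((e - e ^ 3) / 12) (imgC n))"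

definition imgM0 :: "int \<Rightarrow> 'x" where
  "imgM0 n = sc (1 / e) (br (eigenlift (Lgen (- e) 0)) (eigenlift (Mgen e n)))"

lemma P1: "P1 n \<in> car" "q (P1 n) = Poly_Mapping.single (Lgen 0 n) (2 * e)" "br D (P1 n) = 0"
  and P2: "P2 n \<in> car" "q (P2 n) = Poly_Mapping.single (Lgen 0 n) (4 * e)" "br D (P2 n) = 0"
  and imgM0: "imgM0 n \<in> car" "q (imgM0 n) = gen (Mgen 0 n)" "br D (imgM0 n) = 0"
proof -
  have L: "Lgen \<alpha> i \<in> sv_basis \<Gamma>" "sv_weight s (Lgen \<alpha> i) \<noteq> 0" if "\<alpha> \<in> \<Gamma>" "\<alpha> \<noteq> 0" for \<alpha> i
    using that by simp_all
  have M: "Mgen e n \<in> sv_basis \<Gamma>" "sv_weight s (Mgen e n) \<noteq> 0"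
    by simp_all
  have m: "- e \<in> \<Gamma>" "- e \<noteq> 0" "- 2 * e \<in> \<Gamma>" "- 2 * e \<noteq> 0" "2 * e \<in> \<Gamma>" "2 * e \<noteq> 0"
    using uminus_in[OF two_e] by simp_all
  note La = eigenlift[OF L[OF m(1,2)]] and Lb = eigenlift[OF L[OF e]]
    and Lc = eigenlift[OF L[OF m(3,4)]] and Ld = eigenlift[OF L[OF m(5,6)]] and Mb = eigenlift[OF M]
  show "P1 n \<in> car" "q (P1 n) = Poly_Mapping.single (Lgen 0 n) (2 * e)" "br D (P1 n) = 0"
    unfolding P1_def using br_D_br[OF La(1) Lb(1) La(3) Lb(3)]
    by (simp_all add: La Lb q_br bilinear_ext_single)
  show "P2 n \<in> car" "q (P2 n) = Poly_Mapping.single (Lgen 0 n) (4 * e)" "br D (P2 n) = 0"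
    unfolding P2_def using br_D_br[OF Lc(1) Ld(1) Lc(3) Ld(3)]
    by (simp_all add: Lc[simplified] Ld q_br bilinear_ext_single)
  show "imgM0 n \<in> car" "q (imgM0 n) = gen (Mgen 0 n)" "br D (imgM0 n) = 0"
    unfolding imgM0_def using br_D_br[OF La(1) Mb(1) La(3) Mb(3)]
    by (simp_all add: La Mb q_br q_scale br_scale_right D bilinear_ext_single smult_pm_single)
qed

lemma imgC: "imgC n \<in> car" "q (imgC n) = 0"
  by (simp_all add: imgC_def P1 P2 q_scale q_diff smult_pm_single flip: single_diff)

lemma imgL0: "imgL0 n \<in> car" "q (imgL0 n) = gen (Lgen 0 n)" "br D (imgL0 n) = 0"
proof -
  show "imgL0 n \<in> car" "q (imgL0 n) = gen (Lgen 0 n)"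
    by (simp_all add: imgL0_def P1 imgC q_scale q_diff smult_pm_single)
  \<comment> \<open>\<open>imgC n\<close> lies in the kernel of \<open>q\<close>, so only
    \<open>P1 n\<close> matters to \<open>D\<close>.\<close>
  have "br D (P1 n - sc c (imgC n)) = 0" for c
    using br_cong_right[of D "P1 n - sc c (imgC n)" "P1 n"] by (simp add: D P1 imgC q_diff q_scale)
  then show "br D (imgL0 n) = 0"
    by (simp add: imgL0_def br_scale_right D P1 imgC)
qed

text \<open>Weight zero is treated apart because \<open>eigenlift\<close> divides by the weight. The
  value 0 off the basis makes \<open>q_img\<close>, and with it \<open>q_h\<close>, hold for every
  argument.\<close>

definition img :: "'f sv_gen \<Rightarrow> 'x" where
  "img b = (if b \<notin> sv_ext_basis \<Gamma> then 0 else
    case b of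
      Lgen \<alpha> i \<Rightarrow> if \<alpha> = 0 then imgL0 i else eigenlift b
    | Mgen \<alpha> i \<Rightarrow> if \<alpha> = 0 then imgM0 i else eigenlift b
    | Ygen \<alpha> i \<Rightarrow> eigenlift b
    | Cgen n \<Rightarrow> imgC n)"

lemma img_in [simp]: "img b \<in> car"
  by (cases b) (auto simp: img_def imgL0 imgM0 imgC eigenlift Y_weight_nonzero)

lemma q_img: "q (img b) = sv_proj \<Gamma> (gen b)"
  by (cases b) (auto simp: img_def imgL0 imgM0 imgC eigenlift Y_weight_nonzero sv_proj_single q_zero)

lemma br_D_img: "b \<in> sv_basis \<Gamma> \<Longrightarrow> br D (img b) = sc (sv_weight s b) (img b)"
  by (cases b) (auto simp: img_def imgL0 imgM0 eigenlift Y_weight_nonzero)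

definition h :: "('f sv_gen \<Rightarrow>\<^sub>0 'f) \<Rightarrow> 'x" where
  "h = lin_ext sc img"

lemma h_add: "h (x + y) = h x + h y"
  and h_smult: "h (smult_pm c x) = sc c (h x)"
  and h_single: "h (Poly_Mapping.single b k) = sc k (img b)"
  by (simp_all add: h_def X.lin_ext_add X.lin_ext_smult X.lin_ext_single)

lemma h_zero: "h 0 = 0"
  using h_add[of 0 0] by simp

lemma h_uminus: "h (- x) = - h x"
  using h_add[of x "- x"] by (simp add: h_zero minus_unique)

lemma h_in [simp]: "h x \<in> car"
  unfolding h_def lin_ext_def by (intro X.subspace_sum[OF subspace_car] car_scale img_in)

lemma q_h: "q (h x) = sv_proj \<Gamma> x"
proof -
  have "x \<in> supported_on UNIV"
    by (simp add: supported_on_def)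
  then show ?thesis
  proof (induction rule: supported_on_induct)
    case (single b k)
    have "Poly_Mapping.single b k = smult_pm k (gen b)"
      by (simp add: smult_pm_single)
    then show ?case
      by (simp only: h_smult h_single[of _ 1] q_scale q_img sv_proj_smult X.scale_one img_in)
  qed (simp_all add: h_add q_add sv_proj_add h_zero q_zero, simp add: sv_proj_def)
qed

section \<open>The defect of \<open>h\<close> as a cocycle\<close>

definition defect :: "('f sv_gen \<Rightarrow>\<^sub>0 'f) \<Rightarrow> ('f sv_gen \<Rightarrow>\<^sub>0 'f) \<Rightarrow> 'x" where
  "defect x y = br (h x) (h y) - h (E_br x y)"

lemma defect_add_left: "defect (x + y) z = defect x z + defect y z"
  and defect_add_right: "defect z (x + y) = defect z x + defect z y"
  and defect_smult_left: "defect (smult_pm c x) y = sc c (defect x y)"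
  and defect_smult_right: "defect x (smult_pm c y) = sc c (defect x y)"
  by (simp_all add: defect_def bilinear_ext_add_left bilinear_ext_add_right bilinear_ext_smult_left
      bilinear_ext_smult_right h_add h_smult br_add_left br_add_right br_scale_left br_scale_right
      X.scale_right_diff_distrib)

lemma E_br_anti: "E_br x y = - E_br y x"
proof (rule bilinear_ext_antisym)
  show "sv_ext_bracket s a b = - sv_ext_bracket s b a" for a b
    by (subst sv_bracket_anti, subst vir_cocycle_anti) simp
qed

lemma defect_anti: "defect y x = - defect x y"
  using br_anti[of "h y" "h x"] E_br_anti[of y x] by (simp add: defect_def h_uminus)

text \<open>\<open>h\<close> sends C into the kernel of \<open>q\<close>, which is central, and C is
  central in the extension, so both terms of the defect vanish.\<close>

lemma defect_Cgen: "defect x (Poly_Mapping.single (Cgen n) k) = 0"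
  by (simp add: defect_def br_central q_h sv_proj_single bracket_Cgen_right supported_on_single h_zero)

lemma defect_jacobi:
  assumes "a \<in> sv_basis \<Gamma>" "b \<in> sv_basis \<Gamma>" "c \<in> sv_basis \<Gamma>"
  shows "defect (gen a) (sv_ext_bracket s b c) + defect (gen b) (sv_ext_bracket s c a)
    + defect (gen c) (sv_ext_bracket s a b) = 0"
proof -
  \<comment> \<open>The inner elements have the same image under \<open>q\<close>. Hence the first
    terms of the three defects form a Jacobi sum in \<open>X\<close>, and the second terms one in
    the extension.\<close>
  have 1: "br (h (gen a)) (h (sv_ext_bracket s b c)) = br (h (gen a)) (br (h (gen b)) (h (gen c)))"
    if "b \<in> sv_basis \<Gamma>" "c \<in> sv_basis \<Gamma>" for a b c
    using that by (intro br_cong) (simp_all add: q_h q_br sv_proj_bracket_single)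
  have "E_br (gen a) (E_br (gen b) (gen c)) + E_br (gen b) (E_br (gen c) (gen a))
    + E_br (gen c) (E_br (gen a) (gen b)) = 0"
    using lie_algebra_loop_sv_ext assms
    by (simp add: lie_algebra_def loop_sv_ext_def supported_on_single)
  then have "h (E_br (gen a) (sv_ext_bracket s b c)) + h (E_br (gen b) (sv_ext_bracket s c a))
    + h (E_br (gen c) (sv_ext_bracket s a b)) = 0"
    unfolding bilinear_ext_single by (simp only: h_zero flip: h_add)
  then show ?thesis
    unfolding defect_def 1[OF assms(2,3)] 1[OF assms(3,1)] 1[OF assms(1,2)]
    by (simp only: br_jacobi h_in diff_zero flip: add_diff_add)
qed

text \<open>Inside a bracket \<open>h (gen (Lgen 0 0))\<close> may be replaced by \<open>D\<close>,
  which has \<open>img b\<close> as an eigenvector; the cocycle contributes nothing as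
  \<open>\<alpha> ^ 3 - \<alpha>\<close> vanishes at 0.\<close>

lemma defect_L0:
  assumes "b \<in> sv_basis \<Gamma>"
  shows "defect (gen (Lgen 0 0)) (gen b) = 0"
proof -
  have "vir_cocycle (Lgen 0 0) b = 0"
    by (cases b) simp_all
  moreover have "br (h (gen (Lgen 0 0))) (h (gen b)) = br D (img b)"
    by (intro br_cong) (simp_all add: q_h sv_proj_single D q_img h_single)
  ultimately show ?thesis
    using assms by (simp add: defect_def bilinear_ext_single sv_bracket_L0 br_D_img h_single)
qed

lemma defect_normalized:
  shows "defect (gen (Lgen (- e) 0)) (gen (Lgen e n)) = 0"
    and "defect (gen (Lgen (- 2 * e) 0)) (gen (Lgen (2 * e) n)) = 0"
    and "defect (gen (Lgen (- e) 0)) (gen (Mgen e n)) = 0"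
proof -
  have m: "- (2 * e) \<in> \<Gamma>"
    using uminus_in[OF two_e] .
  have img: "img (Lgen (- e) i) = eigenlift (Lgen (- e) i)" "img (Lgen e i) = eigenlift (Lgen e i)"
    "img (Lgen (- (2 * e)) i) = eigenlift (Lgen (- (2 * e)) i)"
    "img (Lgen (2 * e) i) = eigenlift (Lgen (2 * e) i)"
    "img (Mgen e i) = eigenlift (Mgen e i)" "img (Lgen 0 i) = imgL0 i" "img (Mgen 0 i) = imgM0 i"
    "img (Cgen i) = imgC i" for i
    using m by (simp_all add: img_def)
  have P1: "P1 n = sc (2 * e) (imgL0 n) + sc ((e - e ^ 3) / 12) (imgC n)"
    by (simp add: imgL0_def X.scale_right_diff_distrib)
  then show "defect (gen (Lgen (- e) 0)) (gen (Lgen e n)) = 0"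
    by (simp add: defect_def bilinear_ext_single h_add h_single img flip: P1_def)
  \<comment> \<open>Undoing the definition of \<open>imgC\<close> recovers \<open>P2\<close>. Its
    coefficient at \<open>imgC n\<close> turns out to be the one that \<open>vir_cocycle\<close>
    gives for the subscripts \<open>- 2 * e\<close> and \<open>2 * e\<close>.\<close>
  have "sc (- (e ^ 3 / 2)) (imgC n) = P2 n - sc 2 (P1 n)"
    by (simp add: imgC_def)
  then have "P2 n = sc 2 (P1 n) + sc (- (e ^ 3 / 2)) (imgC n)"
    by simp
  also have "\<dots> = sc (4 * e) (imgL0 n) + sc (2 * ((e - e ^ 3) / 12) + - (e ^ 3 / 2)) (imgC n)"
    unfolding P1 by (simp only: X.scale_right_distrib X.scale_left_distrib X.scale_scale add.assoc) simp
  also have "2 * ((e - e ^ 3) / 12) + - (e ^ 3 / 2) = (2 * e - (2 * e) ^ 3) / 12"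
    by (simp add: field_simps power3_eq_cube)
  finally show "defect (gen (Lgen (- 2 * e) 0)) (gen (Lgen (2 * e) n)) = 0"
    unfolding P2_def by (simp add: defect_def bilinear_ext_single h_add h_single img)
  show "defect (gen (Lgen (- e) 0)) (gen (Mgen e n)) = 0"
    by (simp add: defect_def bilinear_ext_single h_single img imgM0_def)
qed

text \<open>A nonzero value would be detected by a linear functional, whose composite with the
  defect is a scalar cocycle and so vanishes by \<open>t_vanishes\<close>.\<close>

lemma defect_gen: "a \<in> sv_basis \<Gamma> \<Longrightarrow> b \<in> sv_basis \<Gamma> \<Longrightarrow> defect (gen a) (gen b) = 0"
proof (rule ccontr)
  assume ab: "a \<in> sv_basis \<Gamma>" "b \<in> sv_basis \<Gamma>" and "defect (gen a) (gen b) \<noteq> 0"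
  then obtain l where l: "Vector_Spaces.linear sc (*) l" "l (defect (gen a) (gen b)) \<noteq> 0"
    using X.ex_linear_functional by blast
  interpret l: Vector_Spaces.linear sc "(*)" l
    by (rule l(1))
  interpret sv_cocycle \<Gamma> s "\<lambda>a y. l (defect (gen a) y)" e
  proof
    show "l (defect (gen a) (sv_ext_bracket s b c)) + l (defect (gen b) (sv_ext_bracket s c a))
      + l (defect (gen c) (sv_ext_bracket s a b)) = 0"
      if "a \<in> sv_basis \<Gamma>" "b \<in> sv_basis \<Gamma>" "c \<in> sv_basis \<Gamma>" for a b c
      using defect_jacobi[OF that] by (simp flip: l.add)
    show "l (defect (gen b) (gen a)) = - l (defect (gen a) (gen b))" for a b
      by (subst defect_anti) (rule l.neg)
  qed (simp_all add: defect_add_right defect_smult_right l.add l.scale defect_Cgen defect_L0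
      defect_normalized[simplified])
  show False
    using t_vanishes[OF ab] l(2) by (simp add: t_def)
qed

lemma defect_vanishes:
  assumes "x \<in> supported_on (sv_ext_basis \<Gamma>)" "y \<in> supported_on (sv_ext_basis \<Gamma>)"
  shows "defect x y = 0"
proof -
  have gen: "defect (gen a) (gen b) = 0" if "a \<in> sv_ext_basis \<Gamma>" "b \<in> sv_ext_basis \<Gamma>" for a b
    using that defect_gen[of a b] defect_Cgen[of _ _ 1] defect_anti[of "gen a" "gen b"] by auto
  have single: "defect (Poly_Mapping.single a k) (Poly_Mapping.single b l) = 0"
    if "a \<in> sv_ext_basis \<Gamma>" "b \<in> sv_ext_basis \<Gamma>" for a b k l
    using gen[OF that] defect_smult_left[of k "gen a" "Poly_Mapping.single b l"]
      defect_smult_right[of "gen a" l "gen b"] by (simp add: smult_pm_single)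
  have zero: "defect 0 z = 0" "defect z 0 = 0" for z
    using defect_add_left[of 0 0 z] defect_add_right[of z 0 0] by simp_all
  have left: "defect (Poly_Mapping.single a k) y = 0" if "a \<in> sv_ext_basis \<Gamma>" for a k
    using assms(2) by (induction rule: supported_on_induct) (simp_all only: zero defect_add_right single[OF that] add_0_left)
  show ?thesis
    using assms(1) by (induction rule: supported_on_induct) (simp_all only: zero defect_add_left left add_0_left)
qed

lemma lie_hom_h: "lie_hom (loop_sv_ext \<Gamma> s) X h"
  using defect_vanishes by (simp add: lie_hom_def loop_sv_ext_def h_add h_smult defect_def)

text \<open>\<open>h\<close> and \<open>h'\<close> have the same composite with \<open>q\<close>, so
  they agree on brackets, and each basis element of the extension is a linear combination of
  brackets.\<close>

lemma h_unique:
  assumes hom: "lie_hom (loop_sv_ext \<Gamma> s) X h'"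
    and qh': "\<forall>x\<in>lcarrier (loop_sv_ext \<Gamma> s). q (h' x) = sv_proj \<Gamma> x"
    and x: "x \<in> lcarrier (loop_sv_ext \<Gamma> s)"
  shows "h' x = h x"
proof -
  let ?E = "supported_on (sv_ext_basis \<Gamma>)"
  define S where "S = {x \<in> ?E. h' x = h x}"
  have h': "h' x \<in> car" "q (h' x) = sv_proj \<Gamma> x" "h' (x + y) = h' x + h' y"
    "h' (smult_pm c x) = sc c (h' x)" "h' (E_br x y) = br (h' x) (h' y)" if "x \<in> ?E" "y \<in> ?E" for x y c
    using hom qh' that by (simp_all add: lie_hom_def loop_sv_ext_def)
  have E_closed: "E_br x y \<in> ?E" if "x \<in> ?E" "y \<in> ?E" for x y
    using that by (intro bilinear_ext_in_supported_on sv_ext_bracket_closed)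
  have S_br: "E_br x y \<in> S" if "x \<in> ?E" "y \<in> ?E" for x y
  proof -
    have "br (h' x) (h' y) = br (h x) (h y)"
      using that by (intro br_cong) (auto simp: h' q_h)
    also have "\<dots> = h (E_br x y)"
      using defect_vanishes[OF that] by (simp add: defect_def)
    finally show ?thesis
      using that by (simp add: S_def h' E_closed)
  qed
  have S_add: "x + y \<in> S" if "x \<in> S" "y \<in> S" for x y
    using that by (simp add: S_def h' h_add supported_on_add)
  have S_smult: "smult_pm c x \<in> S" if "x \<in> S" for x c
    using that by (simp add: S_def h'(4)[of x x] h_smult pm.subspace_scale[OF subspace_supported_on])
  have S_single: "Poly_Mapping.single b l \<in> S" if "Poly_Mapping.single b k \<in> S" "k \<noteq> 0" for b k l
    using S_smult[OF that(1), of "l / k"] that(2) by (simp add: smult_pm_single)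
  have S_gen: "sv_ext_bracket s a b \<in> S" if "a \<in> sv_basis \<Gamma>" "b \<in> sv_basis \<Gamma>" for a b
    using S_br[of "gen a" "gen b"] that by (simp add: supported_on_single bilinear_ext_single)
  \<comment> \<open>Bracketing with \<open>Lgen 0 0\<close> gives such an element back, multiplied
    by its nonzero weight.\<close>
  have nonzero: "Poly_Mapping.single b l \<in> S" if "b \<in> sv_basis \<Gamma>" "sv_weight s b \<noteq> 0" for b l
  proof (rule S_single[OF _ that(2)])
    have "vir_cocycle (Lgen 0 0) b = 0"
      by (cases b) simp_all
    then show "Poly_Mapping.single b (sv_weight s b) \<in> S"
      using S_gen[of "Lgen 0 0" b] that by (simp add: sv_bracket_L0)
  qed
  have M0: "Poly_Mapping.single (Mgen 0 n) l \<in> S" for n l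
    using S_gen[of "Lgen (- e) 0" "Mgen e n"] by (simp add: S_single[of _ e])
  have V: "Poly_Mapping.single (Lgen 0 n) (2 * \<alpha>) + Poly_Mapping.single (Cgen n) ((\<alpha> - \<alpha> ^ 3) / 12) \<in> S"
    if "\<alpha> \<in> \<Gamma>" for \<alpha> n
    using S_gen[of "Lgen (- \<alpha>) 0" "Lgen \<alpha> n"] that by simp
  \<comment> \<open>Subtracting twice \<open>V\<close> at \<open>e\<close> from \<open>V\<close> at
    \<open>2 * e\<close> cancels the L parts and isolates C; afterwards \<open>V\<close> at
    \<open>e\<close> yields \<open>Lgen 0 n\<close>.\<close>
  have C: "Poly_Mapping.single (Cgen n) l \<in> S" for n l
  proof (rule S_single)
    have "Poly_Mapping.single (Cgen n) (- (e ^ 3) / 2) =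
      (Poly_Mapping.single (Lgen 0 n) (2 * (2 * e)) + Poly_Mapping.single (Cgen n) ((2 * e - (2 * e) ^ 3) / 12))
      + smult_pm (- 2) (Poly_Mapping.single (Lgen 0 n) (2 * e) + Poly_Mapping.single (Cgen n) ((e - e ^ 3) / 12))"
      by (rule poly_mapping_eqI, simp only: lookup_add lookup_smult_pm lookup_single)
        (auto simp: when_def field_simps power3_eq_cube)
    also have "\<dots> \<in> S"
      by (intro S_add S_smult V) simp_all
    finally show "Poly_Mapping.single (Cgen n) (- (e ^ 3) / 2) \<in> S" .
  qed simp
  have L0: "Poly_Mapping.single (Lgen 0 n) l \<in> S" for n l
  proof (rule S_single)
    show "Poly_Mapping.single (Lgen 0 n) (2 * e) \<in> S"
      using S_add[OF V[OF e(1), of n] C[of n "- ((e - e ^ 3) / 12)"]]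
      by (simp add: add.assoc flip: single_add)
  qed simp
  have single: "Poly_Mapping.single b l \<in> S" if "b \<in> sv_ext_basis \<Gamma>" for b l
    using that nonzero[of b l] M0 C L0 by (cases "sv_weight s b = 0"; cases b) (auto simp: Y_weight_nonzero)
  have zero: "0 \<in> S"
    using S_smult[OF M0, of 0] by (simp add: smult_pm_single)
  have "x \<in> ?E"
    using x by (simp add: loop_sv_ext_def)
  then have "x \<in> S"
    by (induction rule: supported_on_induct) (auto intro: S_add single zero)
  then show ?thesis by (simp add: S_def)
qed

end

theorem mainTheorem4:
  fixes \<Gamma> :: "'f::field_char_0 set" and s :: 'f
  assumes "additive_subgroup \<Gamma>" and "\<Gamma> \<noteq> UNIV"
    and "s \<notin> \<Gamma>" and "2 * s \<in> \<Gamma>"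
  shows "universal_central_extension TYPE('x::ab_group_add)
           (loop_sv_ext \<Gamma> s) (loop_sv \<Gamma> s) (sv_proj \<Gamma>)"
proof -
  interpret sv_data \<Gamma> s
    using assms by unfold_locales
  show ?thesis
    unfolding universal_central_extension_def
  proof (intro conjI allI impI)
    fix X :: "('f, 'x) lie_struct" and q
    assume "central_extension X (loop_sv \<Gamma> s) q"
    then interpret sv_central_extension \<Gamma> s X q
      by unfold_locales
    show "\<exists>h. lie_hom (loop_sv_ext \<Gamma> s) X h \<and>
        (\<forall>x\<in>lcarrier (loop_sv_ext \<Gamma> s). q (h x) = sv_proj \<Gamma> x) \<and>
        (\<forall>h'. lie_hom (loop_sv_ext \<Gamma> s) X h' \<and>
            (\<forall>x\<in>lcarrier (loop_sv_ext \<Gamma> s). q (h' x) = sv_proj \<Gamma> x) \<longrightarrow>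
            (\<forall>x\<in>lcarrier (loop_sv_ext \<Gamma> s). h' x = h x))"
      using lie_hom_h q_h h_unique by blast
  qed (rule central_extension_loop_sv_ext)
qed

end
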